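(* Fix an integer $k\geq1$ and real numbers $\delta,\gamma,\epsilon>0$ with $\epsilon<1$. Suppose $f\colon X\times Y\to[0,1]$, with $X,Y$ finite nonempty sets, omits $(k,\delta)$-ladders. (1) There are $s_1\leq(9/\epsilon)^{4^{\lceil2\gamma^{-1}\rceil k}}$, $s_2\leq(9/\epsilon)^{4^k}$, and $f$-definable partitions $X=X_1\cup\ldots\cup X_{s_1}$ and $Y=Y_1\cup\ldots\cup Y_{s_2}$ such that for all $(i,j)\in[s_1]\times[s_2]$, $(X_i,Y_j)$ is $\epsilon$-almost $(4\delta+\gamma)$-constant with respect to $f$. (2) If $X$ and $Y$ are sufficiently large (i.e., $|X|,|Y|\geq N$ for some $N$ depending only on the fixed parameters $k,\delta,\gamma,\epsilon$), then there are $\ell_1\leq62(17/\epsilon)^{4^{\lceil2\gamma^{-1}\rceil k}}$, $\ell_2\leq62(17/\epsilon)^{4^k}$, and equipartitions $X=X_1\cup\ldots\cup X_{\ell_1}$ and $Y=Y_1\cup\ldots\cup Y_{\ell_2}$ such that for all $(i,j)\in[\ell_1]\times[\ell_2]$, $(X_i,Y_j)$ is $\epsilon$-almost $(4\delta+\gamma)$-constant with respect to $f$.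
   Context: Conventions: $[n]=\{1,\ldots,n\}$. A partition of a set is a collection of pairwise disjoint nonempty subsets whose union is the set; an equipartition $X=X_1\cup\ldots\cup X_n$ is a partition with $||X_i|-|X_j||\leq1$ for all $i,j$. Ladders: given $k\geq1$ and $\delta>0$, a $(k,\delta)$-ladder for $f\colon X\times Y\to[0,1]$ consists of sequences $(x_1,\ldots,x_k)\in X^k$, $(y_1,\ldots,y_k)\in Y^k$, $(r_1,\ldots,r_k)\in[0,1]^k$ such that for all $i,j\in[k]$: if $i\leq j$ then $f(x_i,y_j)\geq r_i+\delta$, and if $i>j$ then $f(x_i,y_j)\leq r_i$. If no such sequences exist, $f$ omits $(k,\delta)$-ladders. Almost constant pairs: for $A\subseteq X$, $B\subseteq Y$ and $\delta,\epsilon>0$, the pair $(A,B)$ is $\epsilon$-almost $\delta$-constant with respect to $f$ if there is $E\subseteq A\times B$ with $|E|>(1-\epsilon)|A||B|$ such that $|f(x,y)-f(x',y')|<\delta$ for any $(x,y),(x',y')\in E$. Definability: a subset of $X$ is $f$-definable if it is a finite Boolean combination of sets of the form $\{x\in X: f(x,b)\geq r\}$ or $\{x\in X:f(x,b)\leq r\}$ with $b\in Y$ and $r\in[0,1]$. $f$-definable subsets of $Y$ are defined analogously, using sets $\{y\in Y:f(a,y)\geq r\}$ or $\{y\in Y:f(a,y)\leq r\}$ with $a\in X$, $r\in[0,1]$. A partition of $X$ or $Y$ is $f$-definable if all of its pieces are $f$-definable. *)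

theory Defs
  imports Complex_Main "HOL-Library.Disjoint_Sets"
begin

definition unit_valued :: "'a set \<Rightarrow> 'b set \<Rightarrow> ('a \<Rightarrow> 'b \<Rightarrow> real) \<Rightarrow> bool" where
  "unit_valued X Y f \<longleftrightarrow> (\<forall>x\<in>X. \<forall>y\<in>Y. f x y \<in> {0..1})"

text \<open>Sequences of length \<open>k\<close> are functions on \<open>nat\<close>, of which only the values on \<open>{1..k}\<close> matter.\<close>

definition is_ladder ::
  "nat \<Rightarrow> real \<Rightarrow> 'a set \<Rightarrow> 'b set \<Rightarrow> ('a \<Rightarrow> 'b \<Rightarrow> real)
    \<Rightarrow> (nat \<Rightarrow> 'a) \<Rightarrow> (nat \<Rightarrow> 'b) \<Rightarrow> (nat \<Rightarrow> real) \<Rightarrow> bool" where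
  "is_ladder k \<delta> X Y f x y r \<longleftrightarrow>
     (\<forall>i\<in>{1..k}. x i \<in> X \<and> y i \<in> Y \<and> r i \<in> {0..1}) \<and>
     (\<forall>i\<in>{1..k}. \<forall>j\<in>{1..k}.
        (i \<le> j \<longrightarrow> f (x i) (y j) \<ge> r i + \<delta>) \<and>
        (i > j \<longrightarrow> f (x i) (y j) \<le> r i))"

definition omits_ladders ::
  "nat \<Rightarrow> real \<Rightarrow> 'a set \<Rightarrow> 'b set \<Rightarrow> ('a \<Rightarrow> 'b \<Rightarrow> real) \<Rightarrow> bool" where
  "omits_ladders k \<delta> X Y f \<longleftrightarrow> \<not> (\<exists>x y r. is_ladder k \<delta> X Y f x y r)"

definition almost_constant ::
  "('a \<Rightarrow> 'b \<Rightarrow> real) \<Rightarrow> real \<Rightarrow> real \<Rightarrow> 'a set \<Rightarrow> 'b set \<Rightarrow> bool" where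
  "almost_constant f \<epsilon> \<delta> A B \<longleftrightarrow>
     (\<exists>E \<subseteq> A \<times> B.
        real (card E) > (1 - \<epsilon>) * real (card A) * real (card B) \<and>
        (\<forall>(x, y)\<in>E. \<forall>(x', y')\<in>E. \<bar>f x y - f x' y'\<bar> < \<delta>))"

text \<open>Finite Boolean combinations of members of \<open>G\<close>, with complements taken inside \<open>\<Omega>\<close>.\<close>

inductive_set boolean_combinations :: "'a set \<Rightarrow> 'a set set \<Rightarrow> 'a set set"
  for \<Omega> :: "'a set" and G :: "'a set set" where
  basic: "A \<in> G \<Longrightarrow> A \<in> boolean_combinations \<Omega> G"
| compl: "A \<in> boolean_combinations \<Omega> G \<Longrightarrow> \<Omega> - A \<in> boolean_combinations \<Omega> G"
| union: "A \<in> boolean_combinations \<Omega> G \<Longrightarrow> B \<in> boolean_combinations \<Omega> G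
    \<Longrightarrow> A \<union> B \<in> boolean_combinations \<Omega> G"
| inter: "A \<in> boolean_combinations \<Omega> G \<Longrightarrow> B \<in> boolean_combinations \<Omega> G
    \<Longrightarrow> A \<inter> B \<in> boolean_combinations \<Omega> G"

definition level_sets :: "'a set \<Rightarrow> 'b set \<Rightarrow> ('a \<Rightarrow> 'b \<Rightarrow> real) \<Rightarrow> 'a set set" where
  "level_sets X Y f =
     {{x \<in> X. f x b \<ge> r} | b r. b \<in> Y \<and> r \<in> {0..1}} \<union>
     {{x \<in> X. f x b \<le> r} | b r. b \<in> Y \<and> r \<in> {0..1}}"

text \<open>For subsets of the second factor \<open>Y\<close>, this is applied to the transpose:
  \<open>definable Y X (\<lambda>y x. f x y)\<close>.\<close>

definition definable :: "'a set \<Rightarrow> 'b set \<Rightarrow> ('a \<Rightarrow> 'b \<Rightarrow> real) \<Rightarrow> 'a set \<Rightarrow> bool" where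
  "definable X Y f A \<longleftrightarrow> A \<in> boolean_combinations X (level_sets X Y f)"

definition definable_partition ::
  "'a set \<Rightarrow> 'b set \<Rightarrow> ('a \<Rightarrow> 'b \<Rightarrow> real) \<Rightarrow> 'a set set \<Rightarrow> bool" where
  "definable_partition X Y f P \<longleftrightarrow> partition_on X P \<and> (\<forall>A\<in>P. definable X Y f A)"

definition equipartition :: "'a set \<Rightarrow> 'a set set \<Rightarrow> bool" where
  "equipartition X P \<longleftrightarrow>
     partition_on X P \<and> (\<forall>A\<in>P. \<forall>B\<in>P. \<bar>int (card A) - int (card B)\<bar> \<le> 1)"

end

theory Submission
  imports Defs "HOL-Library.FuncSet"
begin

text \<open>If a set \<open>B \<subseteq> Y\<close> is cut by some \<open>f x\<close> into two sizeable parts \<open>f x \<le> r\<close> and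
  \<open>f x \<ge> r + 2 * \<delta>\<close>, pass to both parts and repeat. A complete binary tree of height
  \<open>2 ^ (2 * k - 1) - 1\<close> of such cuts yields a \<open>(k, \<delta>)\<close>-ladder, by a Ramsey argument. So without
  ladders every set contains a definable subset of positive relative density on which each \<open>f x\<close>
  lies almost entirely in an interval of length \<open>2 * \<delta>\<close>. Removing such subsets greedily, and adding
  the small remainder to a large one of them, partitions \<open>Y\<close>. Rounding the thresholds \<open>r\<close> shows that
  the transpose of \<open>f\<close> omits \<open>(nat \<lceil>2 / \<gamma>\<rceil> * k, \<delta> + \<gamma> / 2)\<close>-ladders, which partitions \<open>X\<close> in
  the same way with intervals of length \<open>2 * \<delta> + \<gamma>\<close>. On a pair of pieces the row intervals and the
  column intervals must meet for most points, which confines most values of \<open>f\<close> to an interval whose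
  length is the sum \<open>4 * \<delta> + \<gamma>\<close>.

  For equipartitions, the pieces are cut into parts of equal size. The points of a piece are
  distributed over its parts so that the densities of exceptional points, relative to each of the
  boundedly many sets on the other side, are nearly preserved.\<close>

section \<open>Trees of cuts and the ladders they contain\<close>

text \<open>A complete binary tree of height \<open>n\<close> with questions from \<open>Q\<close>
  at its inner nodes and nonempty sets at its leaves. The two subtrees choose their questions
  independently, and \<open>L q\<close> and \<open>U q\<close> need not cover everything: in the
  application a gap lies between them.\<close>

primrec splits :: "('q \<Rightarrow> 'b set) \<Rightarrow> ('q \<Rightarrow> 'b set) \<Rightarrow> nat \<Rightarrow> 'q set \<Rightarrow> 'b set \<Rightarrow> bool" where
  "splits L U 0 Q B \<longleftrightarrow> B \<noteq> {}"
| "splits L U (Suc n) Q B \<longleftrightarrow>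
     (\<exists>q\<in>Q. splits L U n Q (B \<inter> L q) \<and> splits L U n Q (B \<inter> U q))"

lemma splits_mono:
  "splits L U n Q B \<Longrightarrow> Q \<subseteq> Q' \<Longrightarrow> B \<subseteq> B' \<Longrightarrow> splits L U n Q' B'"
proof (induction n arbitrary: B B')
  case (Suc n)
  then obtain q where q: "q \<in> Q" "splits L U n Q (B \<inter> L q)" "splits L U n Q (B \<inter> U q)"
    by auto
  have "splits L U n Q' (B' \<inter> L q)"
    using Suc.prems by (intro Suc.IH[OF q(2)]) auto
  moreover have "splits L U n Q' (B' \<inter> U q)"
    using Suc.prems by (intro Suc.IH[OF q(3)]) auto
  ultimately show ?case using q(1) Suc.prems by auto
qed auto

lemma splits_nonempty: "splits L U n Q B \<Longrightarrow> B \<noteq> {}"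
  by (induction n arbitrary: B) auto

text \<open>Ramsey for trees with questions of two colours. If the root question lies in
  \<open>Q1\<close>, then either one half already contains a tree of height \<open>b\<close> over
  \<open>Q2\<close>, or both halves contain trees of height \<open>a - 1\<close> over
  \<open>Q1\<close>, which the root joins. The other colour is symmetric.\<close>

lemma splits_ramsey:
  assumes "splits L U n (Q1 \<union> Q2) B" and "a + b \<le> Suc n"
  shows "splits L U a Q1 B \<or> splits L U b Q2 B"
  using assms
proof (induction n arbitrary: a b B)
  case 0
  then have "a = 0 \<or> b = 0" by auto
  with 0 show ?case by auto
next
  case (Suc n)
  show ?case
  proof (cases "a = 0 \<or> b = 0")
    case True
    with splits_nonempty[OF Suc.prems(1)] show ?thesis by auto
  next
    case False
    then obtain a' b' where ab: "a = Suc a'" "b = Suc b'"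
      by (metis not0_implies_Suc)
    from Suc.prems(1) obtain q where q: "q \<in> Q1 \<union> Q2"
      and l: "splits L U n (Q1 \<union> Q2) (B \<inter> L q)" and u: "splits L U n (Q1 \<union> Q2) (B \<inter> U q)"
      by auto
    have mono: "splits L U i Q' (B \<inter> S) \<Longrightarrow> splits L U i Q' B" for i Q' S
      by (erule splits_mono) auto
    from q show ?thesis
    proof
      assume "q \<in> Q1"
      have "splits L U a' Q1 (B \<inter> L q) \<or> splits L U b Q2 (B \<inter> L q)"
        "splits L U a' Q1 (B \<inter> U q) \<or> splits L U b Q2 (B \<inter> U q)"
        using Suc.prems(2) ab by (intro Suc.IH l u; simp)+
      then consider "splits L U b Q2 B" | "splits L U a' Q1 (B \<inter> L q)" "splits L U a' Q1 (B \<inter> U q)"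
        by (blast dest: mono)
      with \<open>q \<in> Q1\<close> show ?thesis by cases (auto simp: ab(1))
    next
      assume "q \<in> Q2"
      have "splits L U a Q1 (B \<inter> L q) \<or> splits L U b' Q2 (B \<inter> L q)"
        "splits L U a Q1 (B \<inter> U q) \<or> splits L U b' Q2 (B \<inter> U q)"
        using Suc.prems(2) ab by (intro Suc.IH l u; simp)+
      then consider "splits L U a Q1 B" | "splits L U b' Q2 (B \<inter> L q)" "splits L U b' Q2 (B \<inter> U q)"
        by (blast dest: mono)
      with \<open>q \<in> Q2\<close> show ?thesis by cases (auto simp: ab(2))
    qed
  qed
qed

text \<open>One branch of a tree, with witnesses. Each stage picks a point that passes
  \<open>R\<close> for its own question and, as the question set is filtered, for all later ones;
  all later points then lie in \<open>S q\<close>. The result is a half graph between questions and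
  points.\<close>

primrec descent :: "('q \<Rightarrow> 'b set) \<Rightarrow> ('q \<Rightarrow> 'b \<Rightarrow> bool) \<Rightarrow> nat \<Rightarrow> 'q set \<Rightarrow> 'b set \<Rightarrow> bool" where
  "descent S R 0 Q B \<longleftrightarrow> B \<noteq> {}"
| "descent S R (Suc n) Q B \<longleftrightarrow>
     (\<exists>q\<in>Q. \<exists>y\<in>B. R q y \<and> descent S R n {q'\<in>Q. R q' y} (B \<inter> S q))"

lemma descent_mono:
  "descent S R n Q B \<Longrightarrow> Q \<subseteq> Q' \<Longrightarrow> B \<subseteq> B' \<Longrightarrow> descent S R n Q' B'"
proof (induction n arbitrary: Q Q' B B')
  case (Suc n)
  then obtain q y where q: "q \<in> Q" "y \<in> B" "R q y"
    and d: "descent S R n {q'\<in>Q. R q' y} (B \<inter> S q)"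
    by auto
  have "descent S R n {q'\<in>Q'. R q' y} (B' \<inter> S q)"
    using Suc.prems by (auto intro!: Suc.IH[OF d])
  with q Suc.prems show ?case by auto
qed auto

text \<open>The questions of a tree have a gap, \<open>R\<close> being the test at the middle of the gap. A descent
  through the tree meets stages of two kinds, according to the side of the test on which the
  remaining questions place the chosen \<open>y\<close>. Stages of mixed kinds have no gap in common, so a
  ladder uses stages of one kind only.\<close>

lemma descent_of_splits:
  assumes "splits L U n Q B" and "1 \<le> a + b" and "2 ^ (a + b - 1) \<le> Suc n"
  shows "descent L R a Q B \<or> descent U (\<lambda>q y. \<not> R q y) b Q B"
  using assms
proof (induction "a + b" arbitrary: a b n Q B)
  case (Suc l)
  show ?case
  proof (cases "a = 0 \<or> b = 0")
    case True
    with splits_nonempty[OF Suc.prems(1)] show ?thesis by auto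
  next
    case False
    then obtain a' b' where ab: "a = Suc a'" "b = Suc b'"
      by (metis not0_implies_Suc)
    define p :: nat where "p = 2 ^ (a' + b')"
    have "p \<ge> 1" by (simp add: p_def)
    then obtain m where m: "p = Suc m" by (metis Suc_le_D One_nat_def)
    have pn: "p + p \<le> Suc n" using Suc.prems(3) by (simp add: ab p_def)
    obtain y where y: "y \<in> B" using splits_nonempty[OF Suc.prems(1)] by auto
    \<comment> \<open>The point \<open>y\<close> colours the questions by the outcome of the test.
      Below the root of a one-coloured tree of height \<open>p\<close> the height is
      \<open>p - 1\<close>, exactly what the induction demands for \<open>a + b - 1\<close>.\<close>
    define Q1 Q2 where "Q1 = {q\<in>Q. R q y}" and "Q2 = {q\<in>Q. \<not> R q y}"
    have QQ: "Q = Q1 \<union> Q2" "Q1 \<subseteq> Q" "Q2 \<subseteq> Q" by (auto simp: Q1_def Q2_def)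
    have "splits L U p Q1 B \<or> splits L U p Q2 B"
      using splits_ramsey[OF _ pn] Suc.prems(1) QQ(1) by metis
    then show ?thesis
    proof
      assume "splits L U p Q1 B"
      then obtain q where q: "q \<in> Q1" and s: "splits L U m Q1 (B \<inter> L q)" by (auto simp: m)
      \<comment> \<open>All questions of this tree pass the test at \<open>y\<close>, so
        \<open>y\<close> and the root question form a stage of the first kind if the descent
        continues in \<open>L q\<close>. A descent of the second kind found there already has its
        full length.\<close>
      have "descent L R a' Q1 (B \<inter> L q) \<or> descent U (\<lambda>q y. \<not> R q y) b Q1 (B \<inter> L q)"
        using Suc.hyps(2) ab m by (intro Suc.hyps(1)[OF _ s]) (auto simp: p_def)
      then show ?thesis
      proof
        assume "descent L R a' Q1 (B \<inter> L q)"
        with q y show ?thesis unfolding ab Q1_def by auto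
      next
        assume "descent U (\<lambda>q y. \<not> R q y) b Q1 (B \<inter> L q)"
        then have "descent U (\<lambda>q y. \<not> R q y) b Q B" by (rule descent_mono) (use QQ in auto)
        then show ?thesis ..
      qed
    next
      assume "splits L U p Q2 B"
      then obtain q where q: "q \<in> Q2" and s: "splits L U m Q2 (B \<inter> U q)" by (auto simp: m)
      have "descent L R a Q2 (B \<inter> U q) \<or> descent U (\<lambda>q y. \<not> R q y) b' Q2 (B \<inter> U q)"
        using Suc.hyps(2) ab m by (intro Suc.hyps(1)[OF _ s]) (auto simp: p_def)
      then show ?thesis
      proof
        assume "descent U (\<lambda>q y. \<not> R q y) b' Q2 (B \<inter> U q)"
        with q y show ?thesis unfolding ab Q2_def by auto
      next
        assume "descent L R a Q2 (B \<inter> U q)"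
        then have "descent L R a Q B" by (rule descent_mono) (use QQ in auto)
        then show ?thesis ..
      qed
    qed
  qed
qed simp

text \<open>Stage \<open>i\<close> contributes the point \<open>ys i\<close> and the question
  \<open>qs i\<close>; the nonempty set at the end supplies one further point
  \<open>ys n\<close>.\<close>

lemma descent_sequences:
  assumes "descent S R n Q B"
  shows "\<exists>qs ys. (\<forall>i<n. qs i \<in> Q) \<and> (\<forall>j\<le>n. ys j \<in> B) \<and>
    (\<forall>i<n. \<forall>j\<le>n. (j \<le> i \<longrightarrow> R (qs i) (ys j)) \<and> (i < j \<longrightarrow> ys j \<in> S (qs i)))"
  using assms
proof (induction n arbitrary: Q B)
  case 0
  then obtain y where "y \<in> B" by auto
  then show ?case by (intro exI[of _ "\<lambda>_. undefined"] exI[of _ "\<lambda>_. y"]) auto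
next
  case (Suc n)
  then obtain q y where q: "q \<in> Q" "y \<in> B" "R q y"
    and d: "descent S R n {q'\<in>Q. R q' y} (B \<inter> S q)"
    by auto
  from Suc.IH[OF d] obtain qs ys where
    *: "\<forall>i<n. qs i \<in> {q'\<in>Q. R q' y}" "\<forall>j\<le>n. ys j \<in> B \<inter> S q"
    "\<forall>i<n. \<forall>j\<le>n. (j \<le> i \<longrightarrow> R (qs i) (ys j)) \<and> (i < j \<longrightarrow> ys j \<in> S (qs i))"
    by blast
  show ?case
    by (rule exI[of _ "case_nat q qs"], rule exI[of _ "case_nat y ys"])
      (use q * in \<open>auto split: nat.splits\<close>)
qed

text \<open>A gap of \<open>2 * \<delta>\<close> leaves \<open>\<delta>\<close> on either side of
  the midpoint test at \<open>r + \<delta>\<close>, so descents of both kinds give ladders. The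
  height is what \<open>descent_of_splits\<close> asks for with \<open>a = b = k\<close>.\<close>

lemma ladder_of_splits:
  assumes "unit_valued X Y f" and "0 < \<delta>" and "1 \<le> k"
    and s: "splits (\<lambda>(x, r). {y. f x y \<le> r}) (\<lambda>(x, r). {y. r + 2 * \<delta> \<le> f x y}) (2 ^ (2 * k - 1) - 1)
      (X \<times> {r. 0 \<le> r \<and> r + 2 * \<delta> \<le> 1}) Y"
  shows "\<not> omits_ladders k \<delta> X Y f"
proof -
  let ?L = "\<lambda>(x, r). {y. f x y \<le> r}" and ?U = "\<lambda>(x, r). {y. r + 2 * \<delta> \<le> f x y}"
  let ?R = "\<lambda>(x, r) y. r + \<delta> \<le> f x y"
  let ?Q = "X \<times> {r. 0 \<le> r \<and> r + 2 * \<delta> \<le> 1}"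
  have "descent ?L ?R k ?Q Y \<or> descent ?U (\<lambda>q y. \<not> ?R q y) k ?Q Y"
    using \<open>1 \<le> k\<close> by (intro descent_of_splits[OF s]) (auto simp: mult_2)
  then show ?thesis
  proof
    assume "descent ?L ?R k ?Q Y"
    from descent_sequences[OF this] obtain qs ys where
      *: "\<forall>i<k. qs i \<in> ?Q" "\<forall>j\<le>k. ys j \<in> Y"
      "\<forall>i<k. \<forall>j\<le>k. (j \<le> i \<longrightarrow> ?R (qs i) (ys j)) \<and> (i < j \<longrightarrow> ys j \<in> ?L (qs i))"
      by blast
    have **: "fst (qs i) \<in> X" "0 \<le> snd (qs i)" "snd (qs i) \<le> 1" if "i < k" for i
      using *(1) that \<open>0 < \<delta>\<close> by (force simp: mem_Times_iff)+
    \<comment> \<open>Early points pass the test and late points lie below \<open>r\<close>, so the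
      ladder runs through the descent backwards.\<close>
    have "is_ladder k \<delta> X Y f (\<lambda>i. fst (qs (k - i))) (\<lambda>j. ys (k - j)) (\<lambda>i. snd (qs (k - i)))"
      unfolding is_ladder_def using * ** by (auto simp: case_prod_beta)
    then show ?thesis unfolding omits_ladders_def by blast
  next
    assume "descent ?U (\<lambda>q y. \<not> ?R q y) k ?Q Y"
    from descent_sequences[OF this] obtain qs ys where
      *: "\<forall>i<k. qs i \<in> ?Q" "\<forall>j\<le>k. ys j \<in> Y"
      "\<forall>i<k. \<forall>j\<le>k. (j \<le> i \<longrightarrow> \<not> ?R (qs i) (ys j)) \<and> (i < j \<longrightarrow> ys j \<in> ?U (qs i))"
      by blast
    have **: "fst (qs i) \<in> X" "0 \<le> snd (qs i) + \<delta>" "snd (qs i) + \<delta> \<le> 1" if "i < k" for i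
      using *(1) that \<open>0 < \<delta>\<close> by (force simp: mem_Times_iff)+
    \<comment> \<open>Early points now lie below the midpoint and late ones above the gap, so the
      order is kept and the levels are \<open>r + \<delta>\<close>. Questions count from 0 and
      points from 1: \<open>i \<le> j\<close> becomes \<open>i - 1 < j\<close>, and the last rung
      takes the further point \<open>ys k\<close>.\<close>
    have "is_ladder k \<delta> X Y f (\<lambda>i. fst (qs (i - 1))) ys (\<lambda>i. snd (qs (i - 1)) + \<delta>)"
      unfolding is_ladder_def
    proof (intro conjI ballI impI)
      fix i j assume "i \<in> {1..k}" "j \<in> {1..k}"
      then have ij: "i - 1 < k" "j \<le> k" "0 < i" by auto
      note rel = *(3)[rule_format, OF ij(1,2)]
      show "snd (qs (i - 1)) + \<delta> + \<delta> \<le> f (fst (qs (i - 1))) (ys j)" if "i \<le> j"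
      proof -
        have "i - 1 < j" using ij(3) that by auto
        with rel show ?thesis by (simp add: case_prod_beta)
      qed
      show "f (fst (qs (i - 1))) (ys j) \<le> snd (qs (i - 1)) + \<delta>" if "j < i"
      proof -
        have "j \<le> i - 1" using that by auto
        with rel show ?thesis by (simp add: case_prod_beta)
      qed
    qed (use * ** in auto)
    then show ?thesis unfolding omits_ladders_def by blast
  qed
qed

section \<open>Ladders of the transpose\<close>

text \<open>In a ladder of the transpose the levels belong to points of \<open>Y\<close>. Among
  \<open>\<lceil>2 / \<gamma>\<rceil>\<close> classes of width at most \<open>\<gamma> / 2\<close>,
  one contains \<open>k\<close> of the levels by the pigeonhole principle. A single level for that
  class then serves every row of a ladder for \<open>f\<close>, at the price of
  \<open>\<gamma> / 2\<close> in the gap.\<close>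

lemma omits_ladders_transpose:
  assumes om: "omits_ladders k \<delta> X Y f" and \<open>0 < \<delta>\<close> \<open>0 < \<gamma>\<close>
    and uv: "unit_valued X Y f"
  shows "omits_ladders (nat \<lceil>2 / \<gamma>\<rceil> * k) (\<delta> + \<gamma> / 2) Y X (\<lambda>y x. f x y)"
  unfolding omits_ladders_def
proof
  define n where "n = nat \<lceil>2 / \<gamma>\<rceil>"
  have n: "2 / \<gamma> \<le> real n" unfolding n_def by linarith
  then have n0: "0 < n" using \<open>0 < \<gamma>\<close> by (metis divide_pos_pos gr0I not_le of_nat_0 zero_less_numeral)
  have n\<gamma>: "1 / real n \<le> \<gamma> / 2"
    using n n0 \<open>0 < \<gamma>\<close> by (simp add: field_simps)
  assume "\<exists>y x r. is_ladder (nat \<lceil>2 / \<gamma>\<rceil> * k) (\<delta> + \<gamma> / 2) Y X (\<lambda>y x. f x y) y x r"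
  then obtain y x r where l: "is_ladder (n * k) (\<delta> + \<gamma> / 2) Y X (\<lambda>y x. f x y) y x r"
    unfolding n_def by blast
  let ?I = "{1..n * k}"
  have mem: "x i \<in> X" "y i \<in> Y" "0 \<le> r i" if "i \<in> ?I" for i
    using l that by (auto simp: is_ladder_def)
  have up: "r i + (\<delta> + \<gamma> / 2) \<le> f (x j) (y i)" if "i \<in> ?I" "j \<in> ?I" "i \<le> j" for i j
    using l that by (auto simp: is_ladder_def)
  have lo: "f (x j) (y i) \<le> r i" if "i \<in> ?I" "j \<in> ?I" "j < i" for i j
    using l that by (auto simp: is_ladder_def)
  \<comment> \<open>Strictness matters: a level equal to 1 would fall into an additional class
    \<open>n\<close>.\<close>
  have r1: "r i < 1" if "i \<in> ?I" for i
  proof -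
    have "f (x i) (y i) \<le> 1" using uv mem[OF that] by (auto simp: unit_valued_def)
    with up[OF that that] \<open>0 < \<delta>\<close> \<open>0 < \<gamma>\<close> show ?thesis by auto
  qed
  define c where "c i = nat \<lfloor>real n * r i\<rfloor>" for i
  have c: "real (c i) \<le> real n * r i" "real n * r i < real (c i) + 1" if "i \<in> ?I" for i
    using mem(3)[OF that] by (simp_all add: c_def)
  have cn: "c i < n" if "i \<in> ?I" for i
  proof -
    have "real (c i) < real n"
      using c(1)[OF that] r1[OF that] n0 by (smt (verit) mult_less_cancel_left2 of_nat_0_less_iff)
    then show ?thesis by simp
  qed
  have "\<exists>b\<in>{..<n}. k \<le> card {i\<in>?I. c i = b}"
  proof (rule ccontr)
    assume "\<not> ?thesis"
    then have *: "\<forall>b\<in>{..<n}. card {i\<in>?I. c i = b} < k" by force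
    have "card ?I = (\<Sum>b<n. card {i\<in>?I. c i = b})"
      using sum.group[of ?I "{..<n}" c "\<lambda>_. 1::nat"] cn by (simp add: image_subset_iff)
    also have "\<dots> < (\<Sum>b<n. k)"
      using * n0 by (intro sum_strict_mono) auto
    finally show False by simp
  qed
  then obtain b where b: "b < n" "k \<le> card {i\<in>?I. c i = b}" by blast
  then obtain J where J: "J \<subseteq> {i\<in>?I. c i = b}" "card J = k" "finite J"
    using obtain_subset_with_card_n[OF b(2)] by blast
  define g where "g i = sorted_list_of_set J ! i" for i
  have gJ: "g i \<in> J" if "i < k" for i
    using that J(2,3) unfolding g_def
    by (metis nth_mem sorted_list_of_set.length_sorted_key_list_of_set
        sorted_list_of_set.set_sorted_key_list_of_set)
  have gm: "g i < g j" if "i < j" "j < k" for i j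
    using that J(2,3) strict_sorted_list_of_set[of J] unfolding g_def
    by (metis sorted_wrt_nth_less sorted_list_of_set.length_sorted_key_list_of_set)
  have gle: "g i \<le> g j" if "i \<le> j" "j < k" for i j
    using gm that by (cases "i = j") (auto intro: less_imp_le)
  \<comment> \<open>The upper end of the class: values at most \<open>r i\<close> are at most
    \<open>R\<close>, and the larger gap of the transposed ladder covers the difference of at most
    \<open>\<gamma> / 2\<close> between \<open>R\<close> and \<open>r i\<close>.\<close>
  define R where "R = (real b + 1) / real n"
  have R: "r i \<le> R" "R \<le> r i + \<gamma> / 2" if "i \<in> J" for i
  proof -
    have i: "i \<in> ?I" "c i = b" using that J by auto
    show "r i \<le> R" using c(2)[OF i(1)] i(2) n0 by (simp add: R_def field_simps)
    have "R = real b / real n + 1 / real n" by (simp add: R_def add_divide_distrib)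
    moreover have "real b / real n \<le> r i" using c(1)[OF i(1)] i(2) n0 by (simp add: field_simps)
    ultimately show "R \<le> r i + \<gamma> / 2" using n\<gamma> by linarith
  qed
  have R01: "R \<in> {0..1}" using b(1) by (auto simp: R_def field_simps)
  have JI: "i \<in> ?I" if "i \<in> J" for i using that J by auto
  \<comment> \<open>Exchanging rows and columns reverses the order relation of a ladder, hence the
    indices \<open>k - i\<close> into the increasing enumeration \<open>g\<close>.\<close>
  have "is_ladder k \<delta> X Y f (\<lambda>i. x (g (k - i))) (\<lambda>j. y (g (k - j))) (\<lambda>_. R)"
    unfolding is_ladder_def
  proof (intro conjI ballI impI)
    fix i assume "i \<in> {1..k}"
    then show "x (g (k - i)) \<in> X" "y (g (k - i)) \<in> Y"
      by (auto intro!: mem JI gJ)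
  next
    fix i j assume ij: "i \<in> {1..k}" "j \<in> {1..k}"
    then have "k - i < k" "k - j < k" by auto
    note gJ[OF this(1)] gJ[OF this(2)]
    note J' = this JI[OF this(1)] JI[OF this(2)]
    show "R + \<delta> \<le> f (x (g (k - i))) (y (g (k - j)))" if "i \<le> j"
    proof -
      have "g (k - j) \<le> g (k - i)" using ij that by (intro gle) auto
      from up[OF J'(4,3) this] R(2)[OF J'(2)] show ?thesis by linarith
    qed
    show "f (x (g (k - i))) (y (g (k - j))) \<le> R" if "j < i"
    proof -
      have "g (k - i) < g (k - j)" using ij that by (intro gm) auto
      from lo[OF J'(4,3) this] R(1)[OF J'(2)] show ?thesis by linarith
    qed
  qed (use R01 in auto)
  with om show False unfolding omits_ladders_def by blast
qed

section \<open>Nearly constant pairs from row and column intervals\<close>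

text \<open>Passing to the largest value of \<open>V\<close> below \<open>w\<close> replaces a
  strict bound by a nonstrict one. In this way the minimality of a chosen value \<open>w\<close>
  yields a bound on the points strictly below \<open>w\<close>.\<close>

lemma below_eq_at_most:
  fixes g :: "'a \<Rightarrow> real"
  assumes "finite V" and "g ` A \<subseteq> V" and "{x\<in>A. g x < w} \<noteq> {}"
  shows "Max {v\<in>V. v < w} \<in> V" and "Max {v\<in>V. v < w} < w"
    and "{x\<in>A. g x < w} = {x\<in>A. g x \<le> Max {v\<in>V. v < w}}"
proof -
  let ?W = "{v\<in>V. v < w}"
  have fin: "finite ?W" and ne: "?W \<noteq> {}" using assms by auto
  from Max_in[OF fin ne] show m: "Max ?W \<in> V" "Max ?W < w" by auto
  show "{x\<in>A. g x < w} = {x\<in>A. g x \<le> Max ?W}"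
  proof (intro set_eqI iffI)
    fix x assume "x \<in> {x\<in>A. g x < w}"
    then show "x \<in> {x\<in>A. g x \<le> Max ?W}" using assms fin by (auto intro!: Max_ge)
  qed (use m in auto)
qed

text \<open>The window \<open>[w, w + c + d)\<close> starts at the least \<open>w\<close> for which the rectangle
  \<open>{a \<le> w} \<times> {b \<le> w}\<close> holds more than half as many points as the exceptional set. The
  rectangles \<open>{a > w + d} \<times> {b \<le> w}\<close> and \<open>{a \<le> w} \<times> {b > w + c}\<close> are exceptional, and
  regrouping the four factors of the product of their sizes bounds the points above the window.\<close>

lemma almost_constant_of_intervals:
  fixes f :: "'a \<Rightarrow> 'b \<Rightarrow> real"
  assumes fin: "finite A" "finite B" and ne: "A \<noteq> {}" "B \<noteq> {}" and "\<epsilon> < 1" and "0 < c" "0 < d"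
    and I: "\<And>x. x \<in> A \<Longrightarrow> real (card {y\<in>B. f x y \<notin> {a x..<a x + c}}) < \<epsilon> / 4 * real (card B)"
    and J: "\<And>y. y \<in> B \<Longrightarrow> real (card {x\<in>A. f x y \<notin> {b y..<b y + d}}) < \<epsilon> / 4 * real (card A)"
  shows "almost_constant f \<epsilon> (c + d) A B"
proof -
  define Bad1 where "Bad1 = (SIGMA x:A. {y\<in>B. f x y \<notin> {a x..<a x + c}})"
  define Bad2 where "Bad2 = (SIGMA y:B. {x\<in>A. f x y \<notin> {b y..<b y + d}})"
  define Bad where "Bad = {(x, y) \<in> A \<times> B. f x y \<notin> {a x..<a x + c} \<or> f x y \<notin> {b y..<b y + d}}"
  have finBad: "finite Bad" "Bad \<subseteq> A \<times> B"
    unfolding Bad_def using fin by (auto intro: finite_subset[of _ "A \<times> B"])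
  have "real (card Bad1) < (\<Sum>x\<in>A. \<epsilon> / 4 * real (card B))"
    unfolding Bad1_def card_SigmaI[OF fin(1) ballI, OF finite_subset[OF _ fin(2)], OF Collect_restrict]
      of_nat_sum
    using fin ne I by (intro sum_strict_mono) auto
  moreover have "real (card Bad2) < (\<Sum>y\<in>B. \<epsilon> / 4 * real (card A))"
    unfolding Bad2_def card_SigmaI[OF fin(2) ballI, OF finite_subset[OF _ fin(1)], OF Collect_restrict]
      of_nat_sum
    using fin ne J by (intro sum_strict_mono) auto
  moreover have "card Bad \<le> card Bad1 + card Bad2"
  proof -
    have "Bad = Bad1 \<union> prod.swap ` Bad2"
      by (auto simp: Bad_def Bad1_def Bad2_def image_iff)
    then have "card Bad \<le> card Bad1 + card (prod.swap ` Bad2)" by (simp add: card_Un_le)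
    also have "card (prod.swap ` Bad2) = card Bad2" by (intro card_image) auto
    finally show ?thesis .
  qed
  ultimately have cBad: "real (card Bad) < \<epsilon> / 2 * (real (card A) * real (card B))"
    by (simp add: algebra_simps)
  \<comment> \<open>Half the exceptional set: two disjoint parts of it have sizes with sum at most
    \<open>2 * \<beta>\<close>, hence with product at most \<open>\<beta> * \<beta>\<close>.\<close>
  define \<beta> where "\<beta> = real (card Bad) / 2"
  have \<beta>0: "0 \<le> \<beta>" by (simp add: \<beta>_def)
  have "\<epsilon> / 2 * (real (card A) * real (card B)) \<le> 1 * (real (card A) * real (card B))"
    using \<open>\<epsilon> < 1\<close> by (intro mult_right_mono) auto
  then have \<beta>1: "\<beta> < real (card A) * real (card B)" using cBad by (simp add: \<beta>_def)
  define al be where "al w = card {x\<in>A. a x \<le> w}" and "be w = card {y\<in>B. b y \<le> w}" for w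
  define V where "V = a ` A \<union> b ` B"
  have V: "finite V" "V \<noteq> {}" "a ` A \<subseteq> V" "b ` B \<subseteq> V" using fin ne by (auto simp: V_def)
  define C where "C = {v\<in>V. \<beta> < real (al v) * real (be v)}"
  \<comment> \<open>At the largest value both lower sets are everything, and
    \<open>\<epsilon> < 1\<close> makes this rectangle large enough, so a candidate for
    \<open>w\<close> exists.\<close>
  have "{x\<in>A. a x \<le> Max V} = A" "{y\<in>B. b y \<le> Max V} = B" using V by auto
  then have "Max V \<in> C" using V \<beta>1 by (simp add: C_def al_def be_def)
  then have C: "finite C" "C \<noteq> {}" using V(1) by (auto simp: C_def)
  define w where "w = Min C"
  have w: "\<beta> < real (al w) * real (be w)" using Min_in[OF C] by (auto simp: w_def C_def)
  have wmin: "real (al v) * real (be v) \<le> \<beta>" if "v \<in> V" "v < w" for v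
    using that C Min_le[OF C(1), of v] by (force simp: w_def C_def)
  define Ha Hb where "Ha = {x\<in>A. w + d < a x}" and "Hb = {y\<in>B. w + c < b y}"
  define La Lb where "La = {x\<in>A. a x < w}" and "Lb = {y\<in>B. b y < w}"
  have fins: "finite Ha" "finite Hb" "finite La" "finite Lb"
    using fin by (auto simp: Ha_def Hb_def La_def Lb_def)
  have H: "real (card Ha) * real (card Hb) \<le> \<beta>"
  proof (rule ccontr)
    assume *: "\<not> ?thesis"
    let ?V1 = "Ha \<times> {y\<in>B. b y \<le> w}" and ?V2 = "{x\<in>A. a x \<le> w} \<times> Hb"
    have sub: "?V1 \<union> ?V2 \<subseteq> Bad" by (auto simp: Ha_def Hb_def Bad_def)
    have disj: "?V1 \<inter> ?V2 = {}" using \<open>0 < d\<close> by (auto simp: Ha_def)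
    have "card ?V1 + card ?V2 = card (?V1 \<union> ?V2)"
      using fin fins disj by (intro card_Un_disjoint[symmetric]) auto
    also have "\<dots> \<le> card Bad" using sub finBad by (intro card_mono)
    finally have "real (card ?V1) + real (card ?V2) \<le> 2 * \<beta>" by (simp add: \<beta>_def)
    then have "(real (card ?V1) + real (card ?V2))\<^sup>2 \<le> (2 * \<beta>)\<^sup>2" by (intro power_mono) auto
    moreover have "4 * (real (card ?V1) * real (card ?V2)) \<le> (real (card ?V1) + real (card ?V2))\<^sup>2"
      using zero_le_power2[of "real (card ?V1) - real (card ?V2)"]
      by (simp add: power2_eq_square algebra_simps del: card_cartesian_product)
    ultimately have "real (card ?V1) * real (card ?V2) \<le> \<beta> * \<beta>"
      by (simp add: power2_eq_square del: card_cartesian_product)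
    then have "(real (card Ha) * real (card Hb)) * (real (al w) * real (be w)) \<le> \<beta> * \<beta>"
      by (simp add: card_cartesian_product al_def be_def algebra_simps)
    moreover have "\<beta> * \<beta> < (real (card Ha) * real (card Hb)) * (real (al w) * real (be w))"
      using * w \<beta>0 by (intro mult_strict_mono) auto
    ultimately show False by linarith
  qed
  have L: "real (card La) * real (card Lb) \<le> \<beta>"
  proof (cases "La = {} \<or> Lb = {}")
    case True
    then show ?thesis using \<beta>0 by auto
  next
    case False
    then have "La \<noteq> {}" "Lb \<noteq> {}" by auto
    note 1 = below_eq_at_most[OF V(1,3) \<open>La \<noteq> {}\<close>[unfolded La_def]]
    note 2 = below_eq_at_most[OF V(1,4) \<open>Lb \<noteq> {}\<close>[unfolded Lb_def]]
    show ?thesis using wmin[OF 1(1,2)] unfolding La_def Lb_def al_def be_def 1(3) 2(3) .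
  qed
  define E where "E = {(x, y) \<in> A \<times> B. (x, y) \<notin> Bad \<and> w \<le> f x y \<and> f x y < w + (c + d)}"
  have EAB: "E \<subseteq> A \<times> B" by (auto simp: E_def)
  \<comment> \<open>Outside \<open>Bad\<close> the value lies in both intervals. If it is above the
    window, then \<open>a x > w + d\<close> and \<open>b y > w + c\<close>; if it is below, both
    left ends are below \<open>w\<close>. By \<open>H\<close> and \<open>L\<close> the total loss is
    at most \<open>card Bad + 2 * \<beta>\<close>, twice the size of \<open>Bad\<close>.\<close>
  have "A \<times> B \<subseteq> E \<union> (Bad \<union> (Ha \<times> Hb \<union> La \<times> Lb))"
    by (auto simp: E_def Bad_def Ha_def Hb_def La_def Lb_def not_less not_le)
  then have "card (A \<times> B) \<le> card (E \<union> (Bad \<union> (Ha \<times> Hb \<union> La \<times> Lb)))"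
    using fin fins finBad finite_subset[OF EAB] by (intro card_mono) auto
  also have "\<dots> \<le> card E + (card Bad + (card (Ha \<times> Hb) + card (La \<times> Lb)))"
    by (meson card_Un_le add_left_mono order_trans)
  finally have "real (card A) * real (card B)
      \<le> real (card E) + (real (card Bad) + (real (card Ha) * real (card Hb) + real (card La) * real (card Lb)))"
    by (simp add: card_cartesian_product flip: of_nat_mult of_nat_add)
  with H L have "real (card A) * real (card B) \<le> real (card E) + 2 * real (card Bad)"
    by (simp add: \<beta>_def)
  with cBad have "(1 - \<epsilon>) * real (card A) * real (card B) < real (card E)"
    by (simp add: algebra_simps)
  moreover have "\<forall>(x, y)\<in>E. \<forall>(x', y')\<in>E. \<bar>f x y - f x' y'\<bar> < c + d"
    by (fastforce simp: E_def)
  ultimately show ?thesis unfolding almost_constant_def using EAB by blast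
qed

section \<open>Definable partitions into pieces on which every row is concentrated\<close>

text \<open>If a question cuts off two sizeable parts, one of them carries no tree of the next
  smaller height, and the search continues there at the cost of a factor \<open>\<alpha>\<close>. It
  stops after at most \<open>n\<close> cuts, since without a tree of height 1 no question leaves
  both parts nonempty. The predicate \<open>D\<close> carries definability along.\<close>

lemma dense_unsplit_subset:
  assumes "\<not> splits L U (Suc n) Q B" and "finite B" and "B \<noteq> {}" and "0 < \<alpha>" and "\<alpha> \<le> 1"
    and "D B" and D: "\<And>q B. q \<in> Q \<Longrightarrow> D B \<Longrightarrow> D (B \<inter> L q) \<and> D (B \<inter> U q)"
  shows "\<exists>C\<subseteq>B. D C \<and> \<alpha> ^ n * real (card B) \<le> real (card C) \<and>
    (\<forall>q\<in>Q. \<not> (\<alpha> * real (card C) \<le> real (card (C \<inter> L q)) \<and> \<alpha> * real (card C) \<le> real (card (C \<inter> U q))))"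
  using assms(1-3,6)
proof (induction n arbitrary: B)
  case (0 B)
  have "\<not> (\<alpha> * real (card B) \<le> real (card (B \<inter> L q)) \<and> \<alpha> * real (card B) \<le> real (card (B \<inter> U q)))"
    if "q \<in> Q" for q
  proof
    have *: "0 < \<alpha> * real (card B)" using 0 \<open>0 < \<alpha>\<close> by (simp add: card_gt_0_iff)
    assume "\<alpha> * real (card B) \<le> real (card (B \<inter> L q)) \<and> \<alpha> * real (card B) \<le> real (card (B \<inter> U q))"
    with * have "0 < real (card (B \<inter> L q))" "0 < real (card (B \<inter> U q))" by linarith+
    then have "B \<inter> L q \<noteq> {}" "B \<inter> U q \<noteq> {}" by auto
    with 0(1) that show False by auto
  qed
  with 0 show ?case by (intro exI[of _ B]) auto
next
  case (Suc n B)
  show ?case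
  proof (cases "\<exists>q\<in>Q. \<alpha> * real (card B) \<le> real (card (B \<inter> L q)) \<and> \<alpha> * real (card B) \<le> real (card (B \<inter> U q))")
    case False
    have "\<alpha> ^ Suc n * real (card B) \<le> 1 * real (card B)"
      using assms(4,5) by (intro mult_right_mono power_le_one) auto
    with False Suc.prems show ?thesis by (intro exI[of _ B]) auto
  next
    case True
    then obtain q where q: "q \<in> Q" "\<alpha> * real (card B) \<le> real (card (B \<inter> L q))"
      "\<alpha> * real (card B) \<le> real (card (B \<inter> U q))" by blast
    have "\<not> splits L U (Suc n) Q (B \<inter> L q) \<or> \<not> splits L U (Suc n) Q (B \<inter> U q)"
      using Suc.prems(1) q(1) splits.simps(2)[of L U "Suc n" Q B] by blast
    then obtain B' where B': "\<not> splits L U (Suc n) Q B'" "B' \<subseteq> B" "D B'"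
      "\<alpha> * real (card B) \<le> real (card B')"
      using D[OF q(1) Suc.prems(4)] q by blast
    have "0 < \<alpha> * real (card B)" using Suc.prems assms(4) by (simp add: card_gt_0_iff)
    with B'(4) have "B' \<noteq> {}" by auto
    from Suc.IH[OF B'(1) finite_subset[OF B'(2) Suc.prems(2)] this B'(3)]
    obtain C where C: "C \<subseteq> B'" "D C" "\<alpha> ^ n * real (card B') \<le> real (card C)"
      "\<forall>q\<in>Q. \<not> (\<alpha> * real (card C) \<le> real (card (C \<inter> L q)) \<and> \<alpha> * real (card C) \<le> real (card (C \<inter> U q)))"
      by blast
    have "\<alpha> ^ Suc n * real (card B) = \<alpha> ^ n * (\<alpha> * real (card B))" by simp
    also have "\<dots> \<le> \<alpha> ^ n * real (card B')" using B'(4) assms(4) by (intro mult_left_mono) auto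
    also have "\<dots> \<le> real (card C)" by (rule C(3))
    finally show ?thesis using C(1,2,4) B'(2) by (intro exI[of _ C]) auto
  qed
qed

text \<open>Let \<open>a\<close> be the least value at which the lower set reaches the fraction
  \<open>\<alpha>\<close>. Strictly below \<open>a\<close> there is less than that fraction, and
  since the lower set at \<open>a\<close> is sizeable, the upper set from \<open>a + w\<close> on is
  not. If \<open>a + w\<close> exceeds 1, the upper set is empty.\<close>

lemma interval_of_unsplit:
  fixes g :: "'b \<Rightarrow> real"
  assumes fin: "finite C" and ne: "C \<noteq> {}" and g: "\<And>y. y \<in> C \<Longrightarrow> g y \<in> {0..1}"
    and \<alpha>: "0 < \<alpha>" "\<alpha> \<le> 1"
    and unsplit: "\<And>r. 0 \<le> r \<Longrightarrow> r + w \<le> 1 \<Longrightarrow>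
      \<not> (\<alpha> * real (card C) \<le> real (card {y\<in>C. g y \<le> r}) \<and> \<alpha> * real (card C) \<le> real (card {y\<in>C. r + w \<le> g y}))"
  shows "\<exists>a. real (card {y\<in>C. g y \<notin> {a..<a + w}}) < 2 * \<alpha> * real (card C)"
proof -
  have pos: "0 < \<alpha> * real (card C)" using fin ne \<alpha> by (simp add: card_gt_0_iff)
  define M where "M = {v\<in>g ` C. \<alpha> * real (card C) \<le> real (card {y\<in>C. g y \<le> v})}"
  have "{y\<in>C. g y \<le> Max (g ` C)} = C" using fin by auto
  moreover have "\<alpha> * real (card C) \<le> 1 * real (card C)" using \<alpha> by (intro mult_right_mono) auto
  ultimately have "Max (g ` C) \<in> M" using fin ne by (simp add: M_def)
  then have M: "finite M" "M \<noteq> {}" using fin by (auto simp: M_def)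
  define a where "a = Min M"
  have a: "a \<in> g ` C" "\<alpha> * real (card C) \<le> real (card {y\<in>C. g y \<le> a})"
    using Min_in[OF M] by (auto simp: a_def M_def)
  have below: "real (card {y\<in>C. g y < a}) < \<alpha> * real (card C)"
  proof (cases "{y\<in>C. g y < a} = {}")
    case True
    show ?thesis unfolding True using pos by simp
  next
    case False
    note v = below_eq_at_most[OF finite_imageI[OF fin] order_refl False]
    have "Max {v\<in>g ` C. v < a} \<notin> M"
      using v(2) Min_le[OF M(1)] unfolding a_def by (meson not_le)
    then show ?thesis using v(1) unfolding M_def v(3) by auto
  qed
  have above: "real (card {y\<in>C. a + w \<le> g y}) < \<alpha> * real (card C)"
  proof (cases "a + w \<le> 1")
    case True
    with unsplit[of a] a g show ?thesis by force
  next
    case False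
    with g have empty: "{y\<in>C. a + w \<le> g y} = {}" by force
    show ?thesis unfolding empty using pos by simp
  qed
  have "{y\<in>C. g y \<notin> {a..<a + w}} \<subseteq> {y\<in>C. g y < a} \<union> {y\<in>C. a + w \<le> g y}" by auto
  then have "card {y\<in>C. g y \<notin> {a..<a + w}} \<le> card ({y\<in>C. g y < a} \<union> {y\<in>C. a + w \<le> g y})"
    using fin by (intro card_mono) auto
  also have "\<dots> \<le> card {y\<in>C. g y < a} + card {y\<in>C. a + w \<le> g y}" by (rule card_Un_le)
  finally show ?thesis using below above by (intro exI[of _ a]) linarith
qed

text \<open>Each round removes a good subset of density \<open>q\<close> from the remainder
  \<open>Z\<close>, which shrinks by the factor \<open>1 - q\<close>. The set removed first is large
  relative to all of \<open>Y\<close> and can later absorb the remainder.\<close>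

lemma greedy_partition:
  assumes "finite Y" and "Y \<noteq> {}" and "D Y"
    and diff: "\<And>A B. D A \<Longrightarrow> D B \<Longrightarrow> D (A - B)"
    and "0 \<le> q" and "q \<le> 1"
    and sub: "\<And>B. B \<subseteq> Y \<Longrightarrow> B \<noteq> {} \<Longrightarrow> D B \<Longrightarrow>
      \<exists>C\<subseteq>B. C \<noteq> {} \<and> D C \<and> G C \<and> q * real (card B) \<le> real (card C)"
  shows "\<exists>F Z. partition_on (Y - Z) F \<and> card F \<le> m \<and> (\<forall>C\<in>F. D C \<and> G C) \<and> Z \<subseteq> Y \<and> D Z \<and>
    real (card Z) \<le> (1 - q) ^ m * real (card Y) \<and> (0 < m \<longrightarrow> (\<exists>C\<in>F. q * real (card Y) \<le> real (card C)))"
proof (induction m)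
  case 0
  show ?case using assms by (intro exI[of _ "{}"] exI[of _ Y]) (auto simp: partition_on_def)
next
  case (Suc m)
  then obtain F Z where F: "partition_on (Y - Z) F" "card F \<le> m" "\<forall>C\<in>F. D C \<and> G C"
    and Z: "Z \<subseteq> Y" "D Z" "real (card Z) \<le> (1 - q) ^ m * real (card Y)"
    and big: "0 < m \<Longrightarrow> \<exists>C\<in>F. q * real (card Y) \<le> real (card C)" by blast
  have finZ: "finite Z" using Z(1) \<open>finite Y\<close> finite_subset by blast
  show ?case
  proof (cases "Z = {}")
    case True
    have "m \<noteq> 0"
    proof
      assume "m = 0"
      with F \<open>finite Y\<close> have "F = {}"
        by (metis card_eq_0_iff finite_Diff finite_elements le_zero_eq)
      with F(1) True \<open>Y \<noteq> {}\<close> show False by (auto simp: partition_on_def)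
    qed
    then show ?thesis using F Z big True \<open>q \<le> 1\<close> by (intro exI[of _ F] exI[of _ Z]) auto
  next
    case False
    from sub[OF Z(1) False Z(2)] obtain C where C: "C \<subseteq> Z" "C \<noteq> {}" "D C" "G C"
      "q * real (card Z) \<le> real (card C)" by blast
    have "partition_on (Y - (Z - C)) (insert C F)"
      using F(1) C(1,2) Z(1) by (auto simp: partition_on_def disjoint_def)
    moreover have "card (insert C F) \<le> Suc m" using F(2) by (simp add: card_insert_le_m1 card_insert_if le_SucI)
    moreover have "real (card (Z - C)) \<le> (1 - q) ^ Suc m * real (card Y)"
    proof -
      have "card (Z - C) = card Z - card C" "card C \<le> card Z"
        using C(1) finZ by (auto intro: card_Diff_subset card_mono finite_subset)
      then have "real (card (Z - C)) \<le> (1 - q) * real (card Z)" using C(5) by (simp add: algebra_simps)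
      also have "\<dots> \<le> (1 - q) * ((1 - q) ^ m * real (card Y))"
        using Z(3) \<open>q \<le> 1\<close> by (intro mult_left_mono) auto
      finally show ?thesis by (simp add: mult.assoc)
    qed
    moreover have "\<exists>C'\<in>insert C F. q * real (card Y) \<le> real (card C')"
    proof (cases "m = 0")
      case True
      with F \<open>finite Y\<close> have "F = {}"
        by (metis card_eq_0_iff finite_Diff finite_elements le_zero_eq)
      with F(1) Z(1) have "Z = Y" by (auto simp: partition_on_def)
      with C(5) show ?thesis by auto
    qed (use big in auto)
    ultimately show ?thesis using F(3) C Z diff
      by (intro exI[of _ "insert C F"] exI[of _ "Z - C"]) auto
  qed
qed

lemma definable_univ:
  assumes "unit_valued X Y f" and "X \<noteq> {}"
  shows "definable Y X (\<lambda>y x. f x y) Y"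
proof -
  obtain x where "x \<in> X" using assms(2) by auto
  then have "{y\<in>Y. f x y \<ge> 0} \<in> level_sets Y X (\<lambda>y x. f x y)" by (force simp: level_sets_def)
  moreover have "{y\<in>Y. f x y \<ge> 0} = Y" using assms(1) \<open>x \<in> X\<close> by (auto simp: unit_valued_def)
  ultimately show ?thesis unfolding definable_def by (auto intro: boolean_combinations.basic)
qed

text \<open>Without ladders there is no tree of height \<open>h\<close>, so every nonempty definable
  subset of \<open>Y\<close> contains a good one of density \<open>q\<close>, and greedy removal
  applies.\<close>

lemma definable_partition_good:
  fixes f :: "'a \<Rightarrow> 'b \<Rightarrow> real"
  assumes uv: "unit_valued X Y f" and om: "omits_ladders k \<delta> X Y f"
    and X: "X \<noteq> {}" and Y: "finite Y" "Y \<noteq> {}" and k: "1 \<le> k" and \<delta>: "0 < \<delta>" and \<epsilon>: "0 < \<epsilon>" "\<epsilon> < 1"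
    and h: "h = 2 ^ (2 * k - 1) - 1"
  shows "\<exists>Q. definable_partition Y X (\<lambda>y x. f x y) Q \<and> real (card Q) \<le> 2 * real h * (9 / \<epsilon>) ^ h + 1 \<and>
    (\<forall>B\<in>Q. \<forall>x\<in>X. \<exists>a. real (card {y\<in>B. f x y \<notin> {a..<a + 2 * \<delta>}}) < \<epsilon> / 4 * real (card B))"
proof -
  define L where "L = (\<lambda>(x, r). {y. f x y \<le> r})"
  define U where "U = (\<lambda>(x, r). {y. r + 2 * \<delta> \<le> f x y})"
  \<comment> \<open>Both \<open>r\<close> and \<open>r + 2 * \<delta>\<close> lie in the unit
    interval, so both parts of a cut are level sets.\<close>
  define R where "R = X \<times> {r. 0 \<le> r \<and> r + 2 * \<delta> \<le> 1}"
  define D where "D C \<longleftrightarrow> C \<subseteq> Y \<and> definable Y X (\<lambda>y x. f x y) C" for C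
  \<comment> \<open>The fraction \<open>2 * \<alpha>\<close> of exceptional points in a good set,
    which is \<open>8 * \<epsilon> / 36\<close>, and \<open>\<epsilon> / 36\<close> for an absorbed
    remainder add up to \<open>\<epsilon> / 4\<close>.\<close>
  define \<alpha> where "\<alpha> = \<epsilon> / 9"
  define t where "t = 9 / \<epsilon>"
  have \<alpha>: "0 < \<alpha>" "\<alpha> \<le> 1" "\<alpha> = 1 / t" and t: "9 < t" using \<epsilon> by (auto simp: \<alpha>_def t_def field_simps)
  have "(2::nat) ^ 1 \<le> 2 ^ (2 * k - 1)" using k by (intro power_increasing) auto
  then have "h \<noteq> 0" unfolding h by simp
  then obtain n where n: "h = Suc n" by (metis not0_implies_Suc)
  define q where "q = \<alpha> ^ n"
  have q: "0 < q" "q \<le> 1" using \<alpha> by (auto simp: q_def intro: power_le_one)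
  have uv': "f x y \<in> {0..1}" if "x \<in> X" "y \<in> Y" for x y using uv that by (auto simp: unit_valued_def)
  define G where "G C \<longleftrightarrow> (\<forall>x\<in>X. \<exists>a. real (card {y\<in>C. f x y \<notin> {a..<a + 2 * \<delta>}}) < 2 * \<alpha> * real (card C))" for C
  have DY: "D Y" using definable_univ[OF uv X] by (simp add: D_def)
  have Dint: "D (A \<inter> B)" if "D A" "D B" for A B
    using that by (auto simp: D_def definable_def intro: boolean_combinations.inter)
  have Ddiff: "D (A - B)" if "D A" "D B" for A B
  proof -
    have "A - B = A \<inter> (Y - B)" using that by (auto simp: D_def)
    moreover have "D (Y - B)" using that by (auto simp: D_def definable_def intro: boolean_combinations.compl)
    ultimately show ?thesis using Dint that by metis
  qed
  have DLU: "D (B \<inter> L p) \<and> D (B \<inter> U p)" if p': "p \<in> R" and DB: "D B" for p B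
  proof -
    obtain x r where p: "p = (x, r)" "x \<in> X" "0 \<le> r" "r + 2 * \<delta> \<le> 1" using p' by (auto simp: R_def)
    have "{y\<in>Y. f x y \<le> r} \<in> level_sets Y X (\<lambda>y x. f x y)"
      "{y\<in>Y. f x y \<ge> r + 2 * \<delta>} \<in> level_sets Y X (\<lambda>y x. f x y)"
      using p \<delta> unfolding level_sets_def by fastforce+
    then have "D {y\<in>Y. f x y \<le> r}" "D {y\<in>Y. f x y \<ge> r + 2 * \<delta>}"
      by (auto simp: D_def definable_def intro: boolean_combinations.basic)
    then have "D (B \<inter> {y\<in>Y. f x y \<le> r})" "D (B \<inter> {y\<in>Y. f x y \<ge> r + 2 * \<delta>})"
      using Dint DB by auto
    moreover have "B \<inter> {y\<in>Y. f x y \<le> r} = B \<inter> L p" "B \<inter> {y\<in>Y. f x y \<ge> r + 2 * \<delta>} = B \<inter> U p"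
      using DB by (auto simp: p(1) D_def L_def U_def)
    ultimately show ?thesis by simp
  qed
  have "\<not> splits L U h R Y" 
    using ladder_of_splits[OF uv \<delta> k] om unfolding h L_def U_def R_def by blast
  then have nosplit: "\<not> splits L U (Suc n) R B" if "B \<subseteq> Y" for B
    using splits_mono[OF _ order_refl that] unfolding n by blast
  have sub: "\<exists>C\<subseteq>B. C \<noteq> {} \<and> D C \<and> G C \<and> q * real (card B) \<le> real (card C)"
    if B: "B \<subseteq> Y" "B \<noteq> {}" "D B" for B
  proof -
    have finB: "finite B" using B(1) Y(1) finite_subset by blast
    have "\<exists>C\<subseteq>B. D C \<and> \<alpha> ^ n * real (card B) \<le> real (card C) \<and>
        (\<forall>p\<in>R. \<not> (\<alpha> * real (card C) \<le> real (card (C \<inter> L p)) \<and> \<alpha> * real (card C) \<le> real (card (C \<inter> U p))))"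
      by (rule dense_unsplit_subset[where D = D, OF nosplit[OF B(1)] finB B(2) \<alpha>(1,2) B(3)])
        (rule DLU)
    then obtain C where C: "C \<subseteq> B" "D C" "\<alpha> ^ n * real (card B) \<le> real (card C)"
      and u: "\<forall>p\<in>R. \<not> (\<alpha> * real (card C) \<le> real (card (C \<inter> L p)) \<and> \<alpha> * real (card C) \<le> real (card (C \<inter> U p)))"
      by (elim exE conjE)
    have "0 < q * real (card B)" using q finB B(2) by (simp add: card_gt_0_iff)
    with C(3) have ne: "C \<noteq> {}" by (auto simp: q_def)
    have "\<exists>a. real (card {y\<in>C. f x y \<notin> {a..<a + 2 * \<delta>}}) < 2 * \<alpha> * real (card C)" if x: "x \<in> X" for x
    proof (rule interval_of_unsplit[OF _ ne _ \<alpha>(1,2)])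
      show "finite C" using C(1) finB finite_subset by blast
      show "f x y \<in> {0..1}" if "y \<in> C" for y using that C(1) B(1) uv' x by blast
      fix r assume "0 \<le> r" "r + 2 * \<delta> \<le> 1"
      then show "\<not> (\<alpha> * real (card C) \<le> real (card {y\<in>C. f x y \<le> r}) \<and>
          \<alpha> * real (card C) \<le> real (card {y\<in>C. r + 2 * \<delta> \<le> f x y}))"
        using u[rule_format, of "(x, r)"] x by (simp add: R_def L_def U_def Int_def)
    qed
    then have "G C" by (simp add: G_def)
    with C ne show ?thesis unfolding q_def by blast
  qed
  \<comment> \<open>Since \<open>q = 1 / t ^ (h - 1)\<close>, this many rounds give
    \<open>m * q \<ge> 2 * h * t\<close>. Of the two factors \<open>exp (h * t)\<close> that result,
    one exceeds 4 and the other \<open>t ^ h\<close>, so the remainder has density at most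
    \<open>q / (4 * t)\<close>.\<close>
  define m where "m = nat \<lceil>2 * real h * t ^ h\<rceil>"
  have m: "2 * real h * t ^ h \<le> real m" "real m \<le> 2 * real h * t ^ h + 1"
    using t by (auto simp: m_def)
  have "0 < 2 * real h * t ^ h" using t n by auto
  with m(1) have m0: "0 < m" by linarith
  obtain F Z where F: "partition_on (Y - Z) F" "card F \<le> m" "\<forall>C\<in>F. D C \<and> G C"
    and Z: "Z \<subseteq> Y" "D Z" "real (card Z) \<le> (1 - q) ^ m * real (card Y)"
    and big: "\<exists>C\<in>F. q * real (card Y) \<le> real (card C)"
    using greedy_partition[of Y D q G m, OF Y DY Ddiff less_imp_le[OF q(1)] q(2) sub] m0 by blast
  from big obtain C where C: "C \<in> F" "q * real (card Y) \<le> real (card C)" by blast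
  have "(1 - q) ^ m \<le> q / (4 * t)"
  proof -
    have "(1 - q) ^ m \<le> exp (- q) ^ m"
      using exp_ge_add_one_self[of "- q"] q by (intro power_mono) auto
    also have "\<dots> = exp (- (real m * q))" by (simp add: exp_of_nat_mult[symmetric])
    also have "\<dots> \<le> exp (- (2 * real h * t))"
    proof -
      have "2 * real h * t = 2 * real h * t ^ h * q" using t by (simp add: q_def n \<alpha>(3) power_one_over)
      also have "\<dots> \<le> real m * q" using m(1) q by (intro mult_right_mono) auto
      finally show ?thesis by simp
    qed
    also have "\<dots> = 1 / (exp (real h * t) * exp (real h * t))"
      by (simp add: exp_minus inverse_eq_divide flip: exp_add)
    also have "\<dots> \<le> 1 / (4 * t ^ h)"
    proof (intro divide_left_mono mult_mono)
      have "1 * 4 \<le> real h * t" using n t by (intro mult_mono) auto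
      also have "\<dots> \<le> exp (real h * t)" using exp_ge_add_one_self[of "real h * t"] by linarith
      finally show "4 \<le> exp (real h * t)" by simp
      have "t ^ h \<le> exp t ^ h" using t exp_ge_add_one_self[of t] by (intro power_mono; linarith)
      then show "t ^ h \<le> exp (real h * t)" by (simp add: exp_of_nat_mult)
    qed (use t in auto)
    also have "\<dots> = q / (4 * t)" using t by (simp add: q_def n \<alpha>(3) power_one_over)
    finally show ?thesis .
  qed
  then have "(1 - q) ^ m * real (card Y) \<le> q / (4 * t) * real (card Y)" by (intro mult_right_mono) auto
  also have "\<dots> \<le> real (card C) / (4 * t)" using C(2) t by (simp add: divide_simps)
  finally have ZC: "real (card Z) \<le> \<epsilon> / 36 * real (card C)" using Z(3) by (simp add: t_def mult.commute)
  \<comment> \<open>The large set \<open>C\<close> absorbs the remainder, so the number of pieces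
    does not grow.\<close>
  define Q where "Q = insert (C \<union> Z) (F - {C})"
  have finC: "finite C"
    using F(1) C(1) Y(1) by (auto simp: partition_on_def intro: finite_subset)
  have "partition_on Y Q"
  proof (rule partition_onI)
    have un: "\<Union> F = Y - Z" using F(1) by (simp add: partition_on_def)
    then show "\<Union> Q = Y" using C(1) Z(1) by (auto simp: Q_def)
    show "{} \<notin> Q" using F(1) C(1) by (auto simp: Q_def partition_on_def)
    have "A \<inter> B = {}" if "A \<in> F" "B \<in> F" "A \<noteq> B" for A B
      using F(1) that by (auto simp: partition_on_def disjoint_def)
    moreover have "A \<inter> Z = {}" if "A \<in> F" for A using un that by auto
    ultimately show "disjnt A B" if "A \<in> Q" "B \<in> Q" "A \<noteq> B" for A B
      using that C(1) unfolding Q_def disjnt_def by (elim insertE DiffE; simp add: Int_Un_distrib Int_commute)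
  qed
  moreover have "definable Y X (\<lambda>y x. f x y) B" if "B \<in> Q" for B
    using that F(3) C(1) Z(2) by (auto simp: Q_def D_def definable_def intro: boolean_combinations.union)
  moreover have "real (card Q) \<le> 2 * real h * t ^ h + 1"
  proof -
    have "finite F" using F(1) Y(1) finite_elements by blast
    then have "card Q \<le> Suc (card (F - {C}))" by (simp add: Q_def card_insert_if)
    also have "\<dots> = card F" using \<open>finite F\<close> C(1) by (rule card_Suc_Diff1)
    finally have "card Q \<le> card F" .
    then show ?thesis using F(2) m(2) by linarith
  qed
  moreover have "\<exists>a. real (card {y\<in>B. f x y \<notin> {a..<a + 2 * \<delta>}}) < \<epsilon> / 4 * real (card B)"
    if "B \<in> Q" "x \<in> X" for B x
  proof (cases "B = C \<union> Z")
    case True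
    from F(3) C(1) that(2) obtain a where
      a: "real (card {y\<in>C. f x y \<notin> {a..<a + 2 * \<delta>}}) < 2 * \<alpha> * real (card C)" by (auto simp: G_def)
    have "card {y\<in>B. f x y \<notin> {a..<a + 2 * \<delta>}} \<le> card ({y\<in>C. f x y \<notin> {a..<a + 2 * \<delta>}} \<union> Z)"
      using True finC Z(1) Y(1) by (intro card_mono) (auto intro: finite_subset)
    also have "\<dots> \<le> card {y\<in>C. f x y \<notin> {a..<a + 2 * \<delta>}} + card Z" by (rule card_Un_le)
    finally have "real (card {y\<in>B. f x y \<notin> {a..<a + 2 * \<delta>}}) < 2 * \<alpha> * real (card C) + \<epsilon> / 36 * real (card C)"
      using a ZC by linarith
    also have "\<dots> = \<epsilon> / 4 * real (card C)" by (simp add: \<alpha>_def)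
    also have "\<dots> \<le> \<epsilon> / 4 * real (card B)"
      using True \<epsilon> Z(1) Y(1) finC by (intro mult_left_mono) (auto intro!: card_mono intro: finite_subset)
    finally show ?thesis by blast
  next
    case False
    with that have "B \<in> F" by (auto simp: Q_def)
    with F(3) that(2) obtain a where
      a: "real (card {y\<in>B. f x y \<notin> {a..<a + 2 * \<delta>}}) < 2 * \<alpha> * real (card B)" by (auto simp: G_def)
    also have "\<dots> \<le> \<epsilon> / 4 * real (card B)" using \<epsilon> by (intro mult_right_mono) (auto simp: \<alpha>_def)
    finally show ?thesis by blast
  qed
  ultimately show ?thesis unfolding definable_partition_def t_def by blast
qed

section \<open>Equal parts with balanced weights\<close>

text \<open>Appending the points of a new colour after all earlier ones makes every colour an
  interval of positions. Residue classes of positions then meet each colour almost evenly.\<close>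

lemma enumeration_by_colour:
  assumes "finite C" and "finite A" and "c ` A \<subseteq> C"
  shows "\<exists>e. bij_betw e A {0..<card A} \<and> (\<forall>\<kappa>\<in>C. \<exists>u v. e ` {a\<in>A. c a = \<kappa>} = {u..<v})"
  using assms
proof (induction C arbitrary: A rule: finite_induct)
  case empty
  then show ?case by (auto simp: bij_betw_def)
next
  case (insert \<kappa> C A)
  define A' K where "A' = {a\<in>A. c a \<noteq> \<kappa>}" and "K = {a\<in>A. c a = \<kappa>}"
  have fin: "finite A'" "finite K" and disj: "A' \<inter> K = {}" and un: "A' \<union> K = A"
    using insert.prems(1) by (auto simp: A'_def K_def)
  have "c ` A' \<subseteq> C" using insert.prems(2) by (auto simp: A'_def)
  from insert.IH[OF fin(1) this] obtain e where
    e: "bij_betw e A' {0..<card A'}" "\<forall>\<kappa>\<in>C. \<exists>u v. e ` {a\<in>A'. c a = \<kappa>} = {u..<v}" by blast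
  obtain g where g: "bij_betw g K {0..<card K}" using ex_bij_betw_finite_nat[OF fin(2)] by blast
  have cA: "card A = card A' + card K" using card_Un_disjoint[OF fin disj] un by simp
  have "bij_betw ((+) (card A')) {0..<card K} {card A'..<card A}"
    by (auto simp: bij_betw_def cA add.commute[of "card A'"])
  from bij_betw_trans[OF g this] have g': "bij_betw (\<lambda>a. card A' + g a) K {card A'..<card A}"
    by (simp add: comp_def)
  define e' where "e' a = (if c a = \<kappa> then card A' + g a else e a)" for a
  have e'1: "bij_betw e' A' {0..<card A'}"
    using e(1) bij_betw_cong[of A' e' e] by (auto simp: e'_def A'_def)
  have e'2: "bij_betw e' K {card A'..<card A}"
    using g' bij_betw_cong[of K e' "\<lambda>a. card A' + g a"] by (auto simp: e'_def K_def)
  have "bij_betw e' (A' \<union> K) ({0..<card A'} \<union> {card A'..<card A})"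
    by (rule bij_betw_combine[OF e'1 e'2]) auto
  moreover have "{0..<card A'} \<union> {card A'..<card A} = {0..<card A}" using cA by auto
  ultimately have "bij_betw e' A {0..<card A}" using un by simp
  moreover have "\<exists>u v. e' ` {a\<in>A. c a = \<mu>} = {u..<v}" if "\<mu> \<in> insert \<kappa> C" for \<mu>
  proof (cases "\<mu> = \<kappa>")
    case True
    then show ?thesis using bij_betw_imp_surj_on[OF e'2] by (auto simp: K_def)
  next
    case False
    then have "e' ` {a\<in>A. c a = \<mu>} = e ` {a\<in>A'. c a = \<mu>}" by (force simp: e'_def A'_def)
    with e(2) that False show ?thesis by auto
  qed
  ultimately show ?case by blast
qed

lemma card_residue_interval:
  fixes p :: nat
  assumes "0 < p"
  shows "real (card {i\<in>{u..<v}. i mod p = j}) \<le> real (v - u) / real p + 2"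
proof (cases "u < v")
  case True
  have "inj_on (\<lambda>i. i div p) {i\<in>{u..<v}. i mod p = j}"
    by (rule inj_onI) (metis (mono_tags, lifting) div_mult_mod_eq mem_Collect_eq)
  moreover have "(\<lambda>i. i div p) ` {i\<in>{u..<v}. i mod p = j} \<subseteq> {u div p..v div p}"
    by (auto intro!: div_le_mono)
  ultimately have "card {i\<in>{u..<v}. i mod p = j} \<le> card {u div p..v div p}"
    by (rule card_inj_on_le) auto
  then have "real (card {i\<in>{u..<v}. i mod p = j}) \<le> real (v div p) + 1 - real (u div p)"
    using True div_le_mono[of u v p] by (simp add: of_nat_diff)
  moreover have "real (v div p) \<le> real v / real p" by (rule of_nat_div_le_of_nat)
  moreover have "real u / real p - 1 \<le> real (u div p)"
    using floor_divide_of_nat_eq[of u p, where ?'a = real] by linarith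
  ultimately show ?thesis using True by (simp add: of_nat_diff diff_divide_distrib)
qed simp

lemma card_residue_multiple:
  fixes p s :: nat
  assumes "j < p"
  shows "card {i\<in>{0..<p * s}. i mod p = j} = s"
proof -
  have "bij_betw (\<lambda>i. i * p + j) {0..<s} {i\<in>{0..<p * s}. i mod p = j}"
  proof (rule bij_betwI[where g = "\<lambda>i. i div p"])
    show "(\<lambda>i. i * p + j) \<in> {0..<s} \<rightarrow> {i\<in>{0..<p * s}. i mod p = j}"
    proof
      fix i assume "i \<in> {0..<s}"
      then have "Suc i * p \<le> s * p" by (intro mult_le_mono1) auto
      then show "i * p + j \<in> {i\<in>{0..<p * s}. i mod p = j}" using assms by (auto simp: algebra_simps)
    qed
    show "(\<lambda>i. i div p) \<in> {i\<in>{0..<p * s}. i mod p = j} \<rightarrow> {0..<s}"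
      using assms by (auto simp: less_mult_imp_div_less mult.commute)
  qed (use assms in auto)
  from bij_betw_same_card[OF this] show ?thesis by simp
qed

text \<open>Colour the points by their rounded weights, list them colour by colour, and deal them out
  in turn: each part then gets its share of every colour up to a bounded error.\<close>

lemma balanced_split:
  fixes w :: "'i \<Rightarrow> 'a \<Rightarrow> real"
  assumes fin: "finite A" "finite I" and cA: "card A = p * s" and p: "0 < p" and s: "0 < s" and T: "0 < T"
    and w: "\<And>i a. i \<in> I \<Longrightarrow> a \<in> A \<Longrightarrow> w i a \<in> {0..1}"
  shows "\<exists>P. partition_on A P \<and> card P = p \<and> (\<forall>Z\<in>P. card Z = s \<and>
    (\<forall>i\<in>I. (\<Sum>a\<in>Z. w i a) \<le> (\<Sum>a\<in>A. w i a) / real p + real s / real T + 2 * real (T + 1) ^ card I))"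
proof -
  \<comment> \<open>A colour records the weights for all \<open>i\<close>, rounded down to multiples
    of \<open>1 / T\<close>; this leaves at most \<open>(T + 1) ^ card I\<close> colours.\<close>
  define c where "c a = restrict (\<lambda>i. nat \<lfloor>real T * w i a\<rfloor>) I" for a
  define C where "C = I \<rightarrow>\<^sub>E {0..T}"
  have C: "finite C" "card C = (T + 1) ^ card I"
    using fin by (auto simp: C_def card_PiE intro: finite_PiE)
  have cl: "real (c a i) \<le> real T * w i a" "real T * w i a < real (c a i) + 1" "c a i \<le> T"
    if "i \<in> I" "a \<in> A" for i a
  proof -
    have *: "0 \<le> real T * w i a" "real T * w i a \<le> real T * 1"
      using w[OF that] by (auto intro: mult_left_le)
    then show 1: "real (c a i) \<le> real T * w i a" "real T * w i a < real (c a i) + 1"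
      using that by (simp_all add: c_def)
    then show "c a i \<le> T" using * by linarith
  qed
  have cC: "c ` A \<subseteq> C" using cl(3) by (auto simp: C_def PiE_iff c_def)
  from enumeration_by_colour[OF C(1) fin(1) cC] obtain e where
    e: "bij_betw e A {0..<p * s}" and int: "\<forall>\<kappa>\<in>C. \<exists>u v. e ` {a\<in>A. c a = \<kappa>} = {u..<v}"
    unfolding cA by (elim exE conjE)
  note inj = bij_betw_imp_inj_on[OF e]
  define part where "part j = {a\<in>A. e a mod p = j}" for j
  have cpart: "card (part j) = s" if "j < p" for j
  proof -
    have "e ` part j = {i\<in>{0..<p * s}. i mod p = j}"
      using bij_betw_imp_surj_on[OF e] by (auto simp: part_def)
    moreover have "card (e ` part j) = card (part j)"
      by (intro card_image inj_on_subset[OF inj]) (auto simp: part_def)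
    ultimately show ?thesis using card_residue_multiple[OF that] by simp
  qed
  have ne: "part j \<noteq> {}" if "j < p" for j using cpart[OF that] s by auto
  have "inj_on part {..<p}"
  proof (rule inj_onI)
    fix j j' assume j: "j \<in> {..<p}" "part j = part j'"
    with ne[of j] obtain a where "a \<in> part j" by auto
    with j(2) have "a \<in> part j" "a \<in> part j'" by auto
    then show "j = j'" by (simp add: part_def)
  qed
  then have "card (part ` {..<p}) = p" by (simp add: card_image)
  moreover have "partition_on A (part ` {..<p})"
  proof (rule partition_onI)
    show "\<Union> (part ` {..<p}) = A" using p by (auto simp: part_def)
    show "{} \<notin> part ` {..<p}" using ne by auto
  qed (auto simp: part_def disjnt_def)
  moreover have "(\<Sum>a\<in>part j. w i a) \<le> (\<Sum>a\<in>A. w i a) / real p + real s / real T + 2 * real (T + 1) ^ card I"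
    if j: "j < p" and i: "i \<in> I" for i j
  proof -
    have T0: "0 < real T" using T by simp
    have finp: "finite (part j)" using fin by (auto simp: part_def)
    define K where "K \<kappa> = {a\<in>A. c a = \<kappa>}" for \<kappa>
    have Kp: "real (card {a\<in>part j. c a = \<kappa>}) \<le> real (card (K \<kappa>)) / real p + 2" if \<kappa>: "\<kappa> \<in> C" for \<kappa>
    proof -
      from int[rule_format, OF \<kappa>] obtain u v where uv: "e ` K \<kappa> = {u..<v}" by (auto simp: K_def)
      have "card (e ` K \<kappa>) = card (K \<kappa>)" by (intro card_image inj_on_subset[OF inj]) (auto simp: K_def)
      then have "card (K \<kappa>) = v - u" using uv by simp
      moreover have "e ` {a\<in>part j. c a = \<kappa>} = {i\<in>{u..<v}. i mod p = j}"
        unfolding uv[symmetric] by (auto simp: K_def part_def)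
      moreover have "card (e ` {a\<in>part j. c a = \<kappa>}) = card {a\<in>part j. c a = \<kappa>}"
        by (intro card_image inj_on_subset[OF inj]) (auto simp: part_def)
      ultimately show ?thesis using card_residue_interval[OF p, of u v j] by simp
    qed
    \<comment> \<open>Rounding loses at most \<open>1 / T\<close> at each of \<open>s\<close>
      points. Rounded weights are constant on a colour and at most 1, so the error 2 per colour from
      \<open>Kp\<close> costs at most \<open>2 * (T + 1) ^ card I\<close> in total.\<close>
    have "(\<Sum>a\<in>part j. w i a) \<le> (\<Sum>a\<in>part j. real (c a i) / real T + 1 / real T)"
      using cl(2)[OF i] T0 by (intro sum_mono) (auto simp: part_def field_simps intro: less_imp_le)
    also have "\<dots> = (\<Sum>a\<in>part j. real (c a i) / real T) + real s / real T"
      using cpart[OF j] by (simp add: sum.distrib)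
    also have "(\<Sum>a\<in>part j. real (c a i) / real T) = (\<Sum>\<kappa>\<in>C. \<Sum>a\<in>{a\<in>part j. c a = \<kappa>}. real (c a i) / real T)"
      using cC finp C(1) by (intro sum.group[symmetric]) (auto simp: part_def)
    also have "\<dots> = (\<Sum>\<kappa>\<in>C. real (card {a\<in>part j. c a = \<kappa>}) * (real (\<kappa> i) / real T))"
      by (intro sum.cong refl) simp
    also have "\<dots> \<le> (\<Sum>\<kappa>\<in>C. (real (card (K \<kappa>)) / real p + 2) * (real (\<kappa> i) / real T))"
      by (intro sum_mono mult_right_mono Kp) auto
    also have "\<dots> = (\<Sum>\<kappa>\<in>C. real (card (K \<kappa>)) * (real (\<kappa> i) / real T)) / real p + (\<Sum>\<kappa>\<in>C. 2 * (real (\<kappa> i) / real T))"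
      by (simp add: algebra_simps sum.distrib sum_divide_distrib)
    also have "(\<Sum>\<kappa>\<in>C. 2 * (real (\<kappa> i) / real T)) \<le> (\<Sum>\<kappa>\<in>C. 2 * 1)"
      using T0 i by (intro sum_mono mult_left_mono) (auto simp: C_def PiE_iff)
    also have "(\<Sum>\<kappa>\<in>C. 2 * 1 :: real) = 2 * real (T + 1) ^ card I" by (simp add: C(2))
    also have "(\<Sum>\<kappa>\<in>C. real (card (K \<kappa>)) * (real (\<kappa> i) / real T)) = (\<Sum>\<kappa>\<in>C. \<Sum>a\<in>{a\<in>A. c a = \<kappa>}. real (c a i) / real T)"
      by (intro sum.cong refl) (simp add: K_def)
    also have "\<dots> = (\<Sum>a\<in>A. real (c a i) / real T)"
      using cC fin(1) C(1) by (intro sum.group) auto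
    also have "\<dots> \<le> (\<Sum>a\<in>A. w i a)"
      using cl(1)[OF i] T0 by (intro sum_mono) (auto simp: field_simps)
    finally show ?thesis using p by (simp add: divide_right_mono)
  qed
  ultimately show ?thesis using cpart by (intro exI[of _ "part ` {..<p}"]) auto
qed

lemma card_residue_bounds:
  fixes n p j :: nat
  assumes "j < p"
  shows "n div p \<le> card {i\<in>{0..<n}. i mod p = j}" and "card {i\<in>{0..<n}. i mod p = j} \<le> n div p + 1"
proof -
  have n: "p * (n div p) \<le> n" "n \<le> p * (n div p + 1)"
    using dividend_less_times_div[of p n] assms by simp_all
  have "card {i\<in>{0..<p * (n div p)}. i mod p = j} \<le> card {i\<in>{0..<n}. i mod p = j}"
    by (intro card_mono) (auto intro: less_le_trans[OF _ n(1)])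
  then show "n div p \<le> card {i\<in>{0..<n}. i mod p = j}"
    unfolding card_residue_multiple[OF assms] .
  have "card {i\<in>{0..<n}. i mod p = j} \<le> card {i\<in>{0..<p * (n div p + 1)}. i mod p = j}"
    using n(2) by (intro card_mono) auto
  then show "card {i\<in>{0..<n}. i mod p = j} \<le> n div p + 1"
    unfolding card_residue_multiple[OF assms] .
qed

text \<open>Cutting each piece into parts of the common size \<open>s\<close> leaves fewer than \<open>s\<close> points of the
  piece over; all the points left over are then spread evenly over the parts. The factor 2 pays for
  choosing arbitrarily which points of the piece are left over.\<close>

lemma equipartition_refining:
  fixes X :: "'a set" and w :: "'i \<Rightarrow> 'a \<Rightarrow> real"
  assumes fin: "finite X" "finite I" and P: "partition_on X P" "card P \<le> S" and I: "card I \<le> r"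
    and w: "\<And>i x. i \<in> I \<Longrightarrow> x \<in> X \<Longrightarrow> w i x \<in> {0..1}"
    and \<tau>: "0 < \<tau>" and S: "0 < S" and G: "2 / \<tau> + 1 \<le> real G" and T: "2 / \<tau> \<le> real T"
    and c: "S * G * c \<le> card X" "S * G \<le> c" "4 * real (T + 1) ^ r \<le> \<tau> * real c"
  shows "\<exists>P' core. equipartition X P' \<and> card P' \<le> S * G \<and> (\<forall>Z\<in>P'. core Z \<subseteq> Z \<and> core Z \<noteq> {} \<and>
    (1 - \<tau>) * real (card Z) \<le> real (card (core Z)) \<and>
    (\<exists>A\<in>P. core Z \<subseteq> A \<and> (\<forall>i\<in>I. (\<Sum>x\<in>core Z. w i x) \<le>
      real (card (core Z)) * (2 * ((\<Sum>x\<in>A. w i x) / real (card A)) + \<tau>))))"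
proof -
  \<comment> \<open>\<open>S * G\<close> parts of this size would fit into \<open>X\<close>. At most
    \<open>S\<close> pieces each lose less than one part, so at most the fraction
    \<open>1 / G\<close> of \<open>X\<close> is left over.\<close>
  define s where "s = card X div (S * G)"
  have "0 < 2 / \<tau>" using \<tau> by simp
  then have "1 < real G" "0 < real T" using G T by linarith+
  then have G1: "1 < G" and T0: "0 < T" by simp_all
  have SG: "0 < S * G" using S G1 by simp
  have "S * G * c div (S * G) \<le> s" unfolding s_def by (rule div_le_mono[OF c(1)])
  then have cs: "c \<le> s" using SG by simp
  have "1 * 4 \<le> real (T + 1) ^ r * 4" by (intro mult_right_mono one_le_power) auto
  moreover have "\<tau> * real c \<le> \<tau> * real s" using cs \<tau> by (intro mult_left_mono) auto
  ultimately have s4: "4 \<le> \<tau> * real s" and sT: "4 * real (T + 1) ^ r \<le> \<tau> * real s" using c(3) by linarith+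
  have s0: "0 < s" using s4 by (auto intro: gr0I)
  \<comment> \<open>The remainder of the division is below \<open>S * G\<close>, which is at most
    \<open>c\<close> and hence at most the size \<open>s\<close> of one part.\<close>
  have Xs: "S * G * s \<le> card X" "card X < (S * G + 1) * s"
  proof -
    show "S * G * s \<le> card X" by (simp add: s_def)
    have "card X < S * G + S * G * s" using dividend_less_times_div[OF SG] by (simp add: s_def)
    with cs c(2) show "card X < (S * G + 1) * s" by simp
  qed
  have finP: "finite P" using P(1) fin(1) finite_elements by blast
  have AX: "A \<subseteq> X" "finite A" "A \<noteq> {}" if "A \<in> P" for A
    using that P(1) fin(1) by (auto simp: partition_on_def intro: finite_subset)
  define p where "p A = card A div s" for A :: "'a set"
  have pA: "p A * s \<le> card A" "card A < p A * s + s" for A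
    using dividend_less_times_div[OF s0, of "card A"] by (simp_all add: p_def mult.commute)
  have "\<forall>A\<in>P. \<exists>c. fst c \<subseteq> A \<and> card (fst c) = p A * s \<and> partition_on (fst c) (snd c) \<and> card (snd c) = p A \<and>
      (\<forall>Z\<in>snd c. card Z = s \<and> (\<forall>i\<in>I. (\<Sum>x\<in>Z. w i x) \<le> real s * (2 * ((\<Sum>x\<in>A. w i x) / real (card A)) + \<tau>)))"
  proof
    fix A assume A: "A \<in> P"
    show "\<exists>c. fst c \<subseteq> A \<and> card (fst c) = p A * s \<and> partition_on (fst c) (snd c) \<and> card (snd c) = p A \<and>
      (\<forall>Z\<in>snd c. card Z = s \<and> (\<forall>i\<in>I. (\<Sum>x\<in>Z. w i x) \<le> real s * (2 * ((\<Sum>x\<in>A. w i x) / real (card A)) + \<tau>)))"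
    \<comment> \<open>A piece with fewer than \<open>s\<close> points yields no part and is left
      over as a whole.\<close>
    proof (cases "p A = 0")
      case True
      then show ?thesis by (intro exI[of _ "({}, {})"]) (auto simp: partition_on_def)
    next
      case False
      obtain A0 where A0: "A0 \<subseteq> A" "card A0 = p A * s" "finite A0"
        using obtain_subset_with_card_n[OF pA(1)] by blast
      have wA0: "w i a \<in> {0..1}" if "i \<in> I" "a \<in> A0" for i a using that w A0(1) AX(1)[OF A] by blast
      obtain C where C: "partition_on A0 C" "card C = p A" "\<forall>Z\<in>C. card Z = s \<and>
          (\<forall>i\<in>I. (\<Sum>a\<in>Z. w i a) \<le> (\<Sum>a\<in>A0. w i a) / real (p A) + real s / real T + 2 * real (T + 1) ^ card I)"
        using balanced_split[of A0 I "p A" s T w, OF A0(3) fin(2) A0(2) _ s0 T0 wA0] False by blast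
      have bound: "(\<Sum>x\<in>A0. w i x) / real (p A) + real s / real T + 2 * real (T + 1) ^ card I
          \<le> real s * (2 * ((\<Sum>x\<in>A. w i x) / real (card A)) + \<tau>)" if i: "i \<in> I" for i
      proof -
        have w0: "0 \<le> (\<Sum>x\<in>A. w i x)" using w[OF i] AX(1)[OF A] by (intro sum_nonneg) auto
        have "(\<Sum>x\<in>A0. w i x) \<le> (\<Sum>x\<in>A. w i x)"
          using w[OF i] AX[OF A] A0(1) by (intro sum_mono2) auto
        then have "(\<Sum>x\<in>A0. w i x) / real (p A) \<le> (\<Sum>x\<in>A. w i x) * (1 / real (p A))"
          by (simp add: divide_right_mono)
        \<comment> \<open>\<open>A\<close> has fewer than \<open>(p A + 1) * s\<close> points, at
          most twice the \<open>p A * s\<close> points kept in parts; this is the factor 2.\<close>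
        also have "\<dots> \<le> (\<Sum>x\<in>A. w i x) * (2 * real s / real (card A))"
        proof (intro mult_left_mono w0)
          have "1 * s \<le> p A * s" using False by (intro mult_right_mono) auto
          then have "card A \<le> 2 * p A * s" using pA(2)[of A] by linarith
          then have "real (card A) \<le> 2 * real (p A) * real s" by (metis of_nat_le_iff of_nat_mult of_nat_numeral)
          moreover have "0 < card A" using AX[OF A] by (simp add: card_gt_0_iff)
          ultimately show "1 / real (p A) \<le> 2 * real s / real (card A)" using False by (simp add: field_simps)
        qed
        finally have 1: "(\<Sum>x\<in>A0. w i x) / real (p A) \<le> real s * (2 * ((\<Sum>x\<in>A. w i x) / real (card A)))"
          by (simp add: algebra_simps)
        \<comment> \<open>The two error terms of the balanced split get half of
          \<open>\<tau> * s\<close> each: rounding by the choice of \<open>T\<close>, the colours by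
          the size of \<open>s\<close>.\<close>
        have "real s * (1 / real T) \<le> real s * (\<tau> / 2)"
          using T T0 \<tau> by (intro mult_left_mono) (auto simp: field_simps)
        then have 2: "real s / real T \<le> \<tau> * real s / 2" by (simp add: algebra_simps)
        have "real (T + 1) ^ card I \<le> real (T + 1) ^ r" using I by (intro power_increasing) auto
        with sT have 3: "2 * real (T + 1) ^ card I \<le> \<tau> * real s / 2" by simp
        have "real s * (2 * ((\<Sum>x\<in>A. w i x) / real (card A)) + \<tau>) =
            real s * (2 * ((\<Sum>x\<in>A. w i x) / real (card A))) + \<tau> * real s" by (simp add: distrib_left)
        with 1 2 3 show ?thesis by linarith
      qed
      have "(\<Sum>x\<in>Z. w i x) \<le> real s * (2 * ((\<Sum>x\<in>A. w i x) / real (card A)) + \<tau>)"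
        if "Z \<in> C" "i \<in> I" for Z i
        using C(3) that by (intro order_trans[OF _ bound]) auto
      with C A0 show ?thesis by (intro exI[of _ "(A0, C)"]) auto
    qed
  qed
  from bchoice[OF this] obtain ch where ch: "\<forall>A\<in>P. fst (ch A) \<subseteq> A \<and> card (fst (ch A)) = p A * s \<and>
      partition_on (fst (ch A)) (snd (ch A)) \<and> card (snd (ch A)) = p A \<and>
      (\<forall>Z\<in>snd (ch A). card Z = s \<and> (\<forall>i\<in>I. (\<Sum>x\<in>Z. w i x) \<le> real s * (2 * ((\<Sum>x\<in>A. w i x) / real (card A)) + \<tau>)))"
    by blast
  define A0 C where "A0 A = fst (ch A)" and "C A = snd (ch A)" for A
  have A0: "A0 A \<subseteq> A" "card (A0 A) = p A * s" and C: "partition_on (A0 A) (C A)" "card (C A) = p A"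
    if "A \<in> P" for A using ch that by (auto simp: A0_def C_def)
  have CZ: "card Z = s" "\<forall>i\<in>I. (\<Sum>x\<in>Z. w i x) \<le> real s * (2 * ((\<Sum>x\<in>A. w i x) / real (card A)) + \<tau>)"
    if "A \<in> P" "Z \<in> C A" for A Z using ch that by (auto simp: C_def)
  have disjP: "A \<inter> A' = {}" if "A \<in> P" "A' \<in> P" "A \<noteq> A'" for A A'
    using P(1) that by (auto simp: partition_on_def disjoint_def)
  define K where "K = (\<Union>A\<in>P. C A)"
  define X0 where "X0 = (\<Union>A\<in>P. A0 A)"
  have X0: "X0 \<subseteq> X" using A0(1) AX(1) by (auto simp: X0_def)
  have ZA: "Z \<subseteq> A0 A" "Z \<noteq> {}" if "A \<in> P" "Z \<in> C A" for A Z
    using C(1)[OF that(1)] that(2) by (auto simp: partition_on_def)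
  have partK: "partition_on X0 K"
  proof (rule partition_onI)
    have "\<Union> K = (\<Union>A\<in>P. \<Union> (C A))" by (auto simp: K_def)
    also have "\<dots> = X0" using C(1) by (simp add: X0_def partition_on_def)
    finally show "\<Union> K = X0" .
    show "{} \<notin> K" unfolding K_def using ZA(2) by blast
    fix Z Z' assume Z: "Z \<in> K" "Z' \<in> K" "Z \<noteq> Z'"
    then obtain A A' where A: "A \<in> P" "Z \<in> C A" "A' \<in> P" "Z' \<in> C A'" by (auto simp: K_def)
    show "disjnt Z Z'"
    proof (cases "A = A'")
      case True
      then show ?thesis using C(1)[OF A(1)] A Z(3) by (auto simp: partition_on_def disjoint_def disjnt_def)
    next
      case False
      then show ?thesis using disjP[OF A(1,3)] ZA(1)[OF A(1,2)] ZA(1)[OF A(3,4)] A0(1)[OF A(1)] A0(1)[OF A(3)]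
        unfolding disjnt_def by blast
    qed
  qed
  have finK: "finite K" using partK X0 fin(1) finite_elements finite_subset by blast
  have Ks: "card Z = s" if "Z \<in> K" for Z using that CZ(1) by (auto simp: K_def)
  define l where "l = card K"
  have cX0: "card X0 = l * s"
  proof -
    have "s * card K = card (\<Union> K)"
    proof (rule card_partition[OF finK _ Ks])
      show "finite (\<Union> K)" using partK X0 fin(1) by (auto simp: partition_on_def intro: finite_subset)
      show "Z \<inter> Z' = {}" if "Z \<in> K" "Z' \<in> K" "Z \<noteq> Z'" for Z Z'
        using partK that by (auto simp: partition_on_def disjoint_def)
    qed
    then show ?thesis using partK by (simp add: partition_on_def l_def mult.commute)
  qed
  have "card X = (\<Sum>A\<in>P. card A)" 
    using product_partition[OF P(1)] AX(2) by simp
  also have "\<dots> \<le> (\<Sum>A\<in>P. card (A0 A) + s)" using pA(2) A0(2) by (intro sum_mono) (simp add: less_imp_le)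
  also have "\<dots> = card X0 + card P * s"
  proof -
    have "card X0 = (\<Sum>A\<in>P. card (A0 A))"
      unfolding X0_def
    proof (rule card_UN_disjoint[OF finP]; intro ballI impI)
      show "finite (A0 A)" if "A \<in> P" for A using finite_subset[OF A0(1)[OF that] AX(2)[OF that]] .
      show "A0 A \<inter> A0 A' = {}" if "A \<in> P" "A' \<in> P" "A \<noteq> A'" for A A'
        using disjP[OF that] A0(1)[OF that(1)] A0(1)[OF that(2)] by blast
    qed
    then show ?thesis by (simp add: sum.distrib)
  qed
  also have "\<dots> \<le> card X0 + S * s" using P(2) by simp
  finally have XX0: "card X \<le> card X0 + S * s" .
  have "l * s < (S * G + 1) * s" using card_mono[OF fin(1) X0] cX0 Xs(2) by simp
  then have "l < S * G + 1" by (simp only: mult_less_cancel2)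
  then have lle: "l \<le> S * G" by simp
  \<comment> \<open>At most \<open>S * s\<close> points are left over, so there are at least
    \<open>S * (G - 1)\<close> parts over which to spread them.\<close>
  have "S * G * s \<le> (l + S) * s" using Xs(1) XX0 cX0 by (simp add: algebra_simps)
  then have "S * G \<le> l + S" using s0 by (simp only: mult_le_cancel2)
  then have lge: "S * (G - 1) \<le> l" by (simp add: diff_mult_distrib2)
  have l0: "0 < l" using lge S G1 by (metis nat_0_less_mult_iff order_less_le_trans zero_less_diff)
  define R where "R = X - X0"
  have finR: "finite R" using fin(1) by (simp add: R_def)
  have cR: "card R \<le> S * s" using XX0 X0 fin(1) by (simp add: R_def card_Diff_subset finite_subset)
  obtain g where g: "bij_betw g R {0..<card R}" using ex_bij_betw_finite_nat[OF finR] by blast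
  obtain idx where idx: "bij_betw idx K {0..<l}" using ex_bij_betw_finite_nat[OF finK] unfolding l_def by blast
  \<comment> \<open>Leftover points are dealt out by position modulo the number of parts, so the
    extensions differ in size by at most one.\<close>
  define ext where "ext Z = {a\<in>R. g a mod l = idx Z}" for Z
  define d where "d = card R div l"
  have idxl: "idx Z < l" if "Z \<in> K" for Z using bij_betwE[OF idx] that by auto
  have cext: "d \<le> card (ext Z)" "card (ext Z) \<le> d + 1" if "Z \<in> K" for Z
  proof -
    have "g ` ext Z = {i\<in>{0..<card R}. i mod l = idx Z}"
      using bij_betw_imp_surj_on[OF g] by (auto simp: ext_def)
    moreover have "card (g ` ext Z) = card (ext Z)"
      by (intro card_image inj_on_subset[OF bij_betw_imp_inj_on[OF g]]) (auto simp: ext_def)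
    ultimately have e: "card (ext Z) = card {i\<in>{0..<card R}. i mod l = idx Z}" by simp
    show "d \<le> card (ext Z)" "card (ext Z) \<le> d + 1"
      unfolding e d_def by (rule card_residue_bounds[OF idxl[OF that]])+
  qed
  have cZ: "card (Z \<union> ext Z) = s + card (ext Z)" and coreZ: "(Z \<union> ext Z) \<inter> X0 = Z" if "Z \<in> K" for Z
  proof -
    have *: "Z \<subseteq> X0" "ext Z \<inter> X0 = {}" using partK that by (auto simp: partition_on_def ext_def R_def)
    then show "(Z \<union> ext Z) \<inter> X0 = Z" by auto
    have "finite Z" "finite (ext Z)" using * X0 fin(1) finR by (auto simp: ext_def intro: finite_subset)
    then show "card (Z \<union> ext Z) = s + card (ext Z)" using * Ks[OF that] by (subst card_Un_disjoint) auto
  qed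
  define P' where "P' = (\<lambda>Z. Z \<union> ext Z) ` K"
  have "partition_on X P'"
  proof (rule partition_onI)
    have "R \<subseteq> (\<Union>Z\<in>K. ext Z)"
    proof
      fix a assume a: "a \<in> R"
      have "g a mod l \<in> idx ` K" using bij_betw_imp_surj_on[OF idx] l0 by simp
      then show "a \<in> (\<Union>Z\<in>K. ext Z)" using a by (auto simp: ext_def)
    qed
    moreover have "ext Z \<subseteq> R" for Z by (auto simp: ext_def)
    moreover have "\<Union> K = X0" using partK by (simp add: partition_on_def)
    ultimately show "\<Union> P' = X" using X0 unfolding P'_def R_def by blast
    show "{} \<notin> P'" using partK by (auto simp: P'_def partition_on_def)
    fix V V' assume V: "V \<in> P'" "V' \<in> P'" "V \<noteq> V'"
    then obtain Z Z' where Z: "Z \<in> K" "Z' \<in> K" "V = Z \<union> ext Z" "V' = Z' \<union> ext Z'" by (auto simp: P'_def)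
    with V have "Z \<noteq> Z'" by auto
    then have "Z \<inter> Z' = {}" "Z \<union> Z' \<subseteq> X0" using partK Z(1,2) by (auto simp: partition_on_def disjoint_def)
    moreover have "idx Z \<noteq> idx Z'" using bij_betw_imp_inj_on[OF idx] Z(1,2) \<open>Z \<noteq> Z'\<close> by (auto dest: inj_onD)
    ultimately show "disjnt V V'" unfolding Z(3,4) disjnt_def by (auto simp: ext_def R_def)
  qed
  moreover have "\<forall>V\<in>P'. \<forall>V'\<in>P'. \<bar>int (card V) - int (card V')\<bar> \<le> 1"
  proof (intro ballI)
    fix V V' assume "V \<in> P'" "V' \<in> P'"
    then obtain Z Z' where Z: "Z \<in> K" "Z' \<in> K" "V = Z \<union> ext Z" "V' = Z' \<union> ext Z'" by (auto simp: P'_def)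
    show "\<bar>int (card V) - int (card V')\<bar> \<le> 1"
      using cext[OF Z(1)] cext[OF Z(2)] unfolding Z(3,4) cZ[OF Z(1)] cZ[OF Z(2)] by linarith
  qed
  moreover have "card P' \<le> S * G" using card_image_le[OF finK, of "\<lambda>Z. Z \<union> ext Z"] lle by (simp add: P'_def l_def)
  moreover have "V \<inter> X0 \<subseteq> V \<and> V \<inter> X0 \<noteq> {} \<and> (1 - \<tau>) * real (card V) \<le> real (card (V \<inter> X0)) \<and>
      (\<exists>A\<in>P. V \<inter> X0 \<subseteq> A \<and> (\<forall>i\<in>I. (\<Sum>x\<in>V \<inter> X0. w i x) \<le>
        real (card (V \<inter> X0)) * (2 * ((\<Sum>x\<in>A. w i x) / real (card A)) + \<tau>)))" if V: "V \<in> P'" for V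
  proof -
    from V obtain Z where Z: "Z \<in> K" "V = Z \<union> ext Z" by (auto simp: P'_def)
    from Z(1) obtain A where A: "A \<in> P" "Z \<in> C A" by (auto simp: K_def)
    have VZ: "V \<inter> X0 = Z" using coreZ[OF Z(1)] Z(2) by simp
    \<comment> \<open>The share of one part is at most \<open>s / (G - 1)\<close>, which is at most
      \<open>\<tau> * s / 2\<close>, plus 1 for rounding; \<open>4 \<le> \<tau> * s\<close> absorbs
      the 1.\<close>
    have "real (card (ext Z)) \<le> real d + 1" using cext(2)[OF Z(1)] by simp
    also have "real d \<le> real (card R) / real l" unfolding d_def by (rule of_nat_div_le_of_nat)
    also have "\<dots> \<le> real (S * s) / real (S * (G - 1))"
      using cR lge S G1 by (intro frac_le) (simp_all flip: of_nat_mult)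
    also have "\<dots> = real s * (1 / real (G - 1))" using S by simp
    also have "\<dots> \<le> real s * (\<tau> / 2)"
      using G G1 \<tau> by (intro mult_left_mono) (simp_all add: of_nat_diff field_simps)
    finally have e: "real (card (ext Z)) \<le> \<tau> * real s" using s4 by (simp add: algebra_simps)
    have "(1 - \<tau>) * real (card V) = real s + (real (card (ext Z)) - \<tau> * real s) - \<tau> * real (card (ext Z))"
      unfolding Z(2) cZ[OF Z(1)] by (simp add: algebra_simps)
    also have "\<dots> \<le> real s"
    proof -
      have "0 \<le> \<tau> * real (card (ext Z))" using \<tau> by simp
      with e show ?thesis by linarith
    qed
    finally show ?thesis unfolding VZ
      using Z ZA[OF A] A0(1)[OF A(1)] CZ[OF A] A(1) by blast
  qed
  ultimately show ?thesis unfolding equipartition_def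
    by (intro exI[of _ P'] exI[of _ "\<lambda>V. V \<inter> X0"]) auto
qed

section \<open>Numerical bounds\<close>

text \<open>With the tree height \<open>h\<close> and \<open>t = 9 / \<epsilon>\<close> this is
  \<open>2 * h * t ^ h + 1\<close>, which bounds the number of rounds of the greedy removal; the 1
  pays for rounding up.\<close>

definition piece_bound :: "nat \<Rightarrow> real \<Rightarrow> real" where
  "piece_bound k \<epsilon> = 2 * real (2 ^ (2 * k - 1) - 1) * (9 / \<epsilon>) ^ (2 ^ (2 * k - 1) - 1) + 1"

text \<open>Source of the exponent \<open>4 ^ k\<close>: it offers two factors \<open>t ^ h\<close>
  and two single factors \<open>t\<close> to spare.\<close>

lemma tree_height_double:
  assumes "1 \<le> k"
  shows "(4::nat) ^ k = 2 * (2 ^ (2 * k - 1) - 1) + 2"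
proof -
  have "(4::nat) ^ k = 2 ^ (2 * k)" by (simp add: power_mult)
  also have "2 * k = Suc (2 * k - 1)" using assms by simp
  also have "(2::nat) ^ Suc (2 * k - 1) = 2 * (2 ^ (2 * k - 1) - 1) + 2"
    using one_le_power[of "2::nat" "2 * k - 1"] unfolding power_Suc by linarith
  finally show ?thesis .
qed

text \<open>One factor \<open>t ^ h\<close> absorbs \<open>h\<close>, as
  \<open>h \<le> 2 ^ h\<close>, and the spare \<open>t * t\<close> absorbs the constant 3.\<close>

lemma piece_bound_le:
  assumes "1 \<le> k" and "0 < \<epsilon>" and "\<epsilon> < 1"
  shows "piece_bound k \<epsilon> \<le> (9 / \<epsilon>) ^ (4 ^ k)"
proof -
  define h :: nat where "h = 2 ^ (2 * k - 1) - 1"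
  define t where "t = 9 / \<epsilon>"
  have t: "9 \<le> t" using assms by (simp add: t_def field_simps)
  have "real h \<le> 2 ^ h" using of_nat_less_two_power[of h, where ?'a = real] by simp
  also have "\<dots> \<le> t ^ h" using t by (intro power_mono) auto
  finally have "2 * real h * t ^ h + 1 \<le> 2 * t ^ h * t ^ h + t ^ h * t ^ h"
    using t mult_mono[of 1 "t ^ h" 1 "t ^ h"] by (intro add_mono mult_right_mono mult_left_mono) auto
  also have "\<dots> = 3 * (t ^ h * t ^ h)" by simp
  also have "\<dots> \<le> (t * t) * (t ^ h * t ^ h)"
    using t mult_mono[of 9 t 9 t] by (intro mult_right_mono) auto
  also have "\<dots> = t ^ (2 * h + 2)" by (simp add: power_add mult_2 power2_eq_square)
  finally show ?thesis
    unfolding piece_bound_def tree_height_double[OF assms(1)] h_def t_def .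
qed

text \<open>Passing to \<open>\<epsilon> / 8\<close> turns 9 into 72. Because
  \<open>17 ^ 2 = 289\<close> exceeds \<open>4 * 72 = 288\<close>, the power
  \<open>v ^ (2 * h)\<close> dominates \<open>(72 / \<epsilon>) ^ h\<close> with
  \<open>4 ^ h\<close> to spare, which absorbs \<open>2 * h\<close>. The refinement factor
  \<open>24 / \<epsilon>\<close> goes into the spare \<open>v ^ 2\<close>, leaving the constant
  48.\<close>

lemma refined_bound_le:
  assumes "1 \<le> k" and "0 < \<epsilon>" and "\<epsilon> < 1"
  shows "piece_bound k (\<epsilon> / 8) * (24 / \<epsilon>) \<le> 62 * (17 / \<epsilon>) ^ (4 ^ k)"
proof -
  define h :: nat where "h = 2 ^ (2 * k - 1) - 1"
  define v where "v = 17 / \<epsilon>"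
  have v: "17 \<le> v" using assms by (simp add: v_def field_simps)
  have "(9 / (\<epsilon> / 8)) ^ h \<le> (v\<^sup>2 / 4) ^ h"
    using assms by (intro power_mono) (auto simp: v_def field_simps power2_eq_square)
  also have "\<dots> = v ^ (2 * h) / 4 ^ h" by (simp add: power_divide power_mult)
  finally have u: "(9 / (\<epsilon> / 8)) ^ h \<le> v ^ (2 * h) / 4 ^ h" .
  have h4: "2 * real h \<le> 4 ^ h"
  proof (induction h)
    case (Suc h)
    define p where "p = (4::real) ^ h"
    have "1 \<le> p" "2 * real h \<le> p" using Suc by (simp_all add: p_def)
    then show ?case by (simp add: p_def[symmetric])
  qed simp
  have "2 * real h * (9 / (\<epsilon> / 8)) ^ h \<le> 4 ^ h * (v ^ (2 * h) / 4 ^ h)"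
    using u h4 assms by (intro mult_mono) auto
  also have "\<dots> = v ^ (2 * h)" by simp
  finally have "piece_bound k (\<epsilon> / 8) \<le> v ^ (2 * h) + 1" by (simp add: piece_bound_def h_def)
  moreover have "1 \<le> v ^ (2 * h)" using v by simp
  ultimately have "piece_bound k (\<epsilon> / 8) \<le> 2 * v ^ (2 * h)" by linarith
  moreover have "24 / \<epsilon> \<le> 24 * v\<^sup>2"
  proof -
    have "1 / \<epsilon> \<le> v" using assms by (simp add: v_def divide_right_mono)
    moreover have "1 * v \<le> v * v" using v by (intro mult_right_mono) auto
    ultimately show ?thesis by (simp add: power2_eq_square)
  qed
  ultimately have "piece_bound k (\<epsilon> / 8) * (24 / \<epsilon>) \<le> (2 * v ^ (2 * h)) * (24 * v\<^sup>2)"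
    using assms v by (intro mult_mono) auto
  also have "\<dots> = 48 * v ^ (2 * h + 2)" by (simp add: power_add power2_eq_square)
  also have "\<dots> \<le> 62 * v ^ (2 * h + 2)" using v by (intro mult_right_mono) auto
  finally show ?thesis unfolding tree_height_double[OF assms(1)] h_def v_def .
qed

section \<open>Regular partitions of both sides\<close>

text \<open>Rows cut \<open>Y\<close> with intervals of length \<open>2 * \<delta>\<close>. Columns
  cut \<open>X\<close> by way of the transpose: its longer omitted ladders cause the larger bound
  for \<open>P\<close>, and its gap \<open>\<delta> + \<gamma> / 2\<close> gives intervals of length
  \<open>2 * \<delta> + \<gamma>\<close>.\<close>

lemma definable_regular_partitions:
  fixes f :: "'a \<Rightarrow> 'b \<Rightarrow> real"
  assumes k: "1 \<le> k" and \<delta>: "0 < \<delta>" and \<gamma>: "0 < \<gamma>" and \<epsilon>: "0 < \<epsilon>" "\<epsilon> < 1"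
    and X: "finite X" "X \<noteq> {}" and Y: "finite Y" "Y \<noteq> {}"
    and uv: "unit_valued X Y f" and om: "omits_ladders k \<delta> X Y f"
  shows "\<exists>P Q. definable_partition X Y f P \<and> definable_partition Y X (\<lambda>y x. f x y) Q \<and>
    real (card P) \<le> piece_bound (nat \<lceil>2 / \<gamma>\<rceil> * k) \<epsilon> \<and> real (card Q) \<le> piece_bound k \<epsilon> \<and>
    (\<forall>A\<in>P. \<forall>B\<in>Q. almost_constant f \<epsilon> (4 * \<delta> + \<gamma>) A B)"
proof -
  have uv': "unit_valued Y X (\<lambda>y x. f x y)" using uv by (auto simp: unit_valued_def)
  have "0 < \<lceil>2 / \<gamma>\<rceil>" using \<gamma> by simp
  then have K: "1 \<le> nat \<lceil>2 / \<gamma>\<rceil> * k" using k by (simp add: Suc_le_eq)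
  have \<delta>': "0 < \<delta> + \<gamma> / 2" using \<delta> \<gamma> by simp
  obtain Q where Q: "definable_partition Y X (\<lambda>y x. f x y) Q" "real (card Q) \<le> piece_bound k \<epsilon>"
    and Qa: "\<forall>B\<in>Q. \<forall>x\<in>X. \<exists>a. real (card {y\<in>B. f x y \<notin> {a..<a + 2 * \<delta>}}) < \<epsilon> / 4 * real (card B)"
    using definable_partition_good[OF uv om X(2) Y k \<delta> \<epsilon> refl] unfolding piece_bound_def by blast
  obtain P where P: "definable_partition X Y f P" "real (card P) \<le> piece_bound (nat \<lceil>2 / \<gamma>\<rceil> * k) \<epsilon>"
    and Pa: "\<forall>A\<in>P. \<forall>y\<in>Y. \<exists>b. real (card {x\<in>A. f x y \<notin> {b..<b + 2 * (\<delta> + \<gamma> / 2)}}) < \<epsilon> / 4 * real (card A)"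
    using definable_partition_good[OF uv' omits_ladders_transpose[OF om \<delta> \<gamma> uv] Y(2) X K \<delta>' \<epsilon> refl]
    unfolding piece_bound_def by blast
  have "almost_constant f \<epsilon> (4 * \<delta> + \<gamma>) A B" if AB: "A \<in> P" "B \<in> Q" for A B
  proof -
    have sub: "A \<subseteq> X" "B \<subseteq> Y" and ne: "A \<noteq> {}" "B \<noteq> {}"
      using AB P(1) Q(1) by (auto simp: definable_partition_def partition_on_def)
    have fin: "finite A" "finite B" using sub X(1) Y(1) finite_subset by blast+
    have "\<forall>x\<in>A. \<exists>a. real (card {y\<in>B. f x y \<notin> {a..<a + 2 * \<delta>}}) < \<epsilon> / 4 * real (card B)"
      using Qa AB(2) sub(1) by blast
    then obtain a where a: "\<forall>x\<in>A. real (card {y\<in>B. f x y \<notin> {a x..<a x + 2 * \<delta>}}) < \<epsilon> / 4 * real (card B)"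
      by (rule bchoice[THEN exE])
    have "\<forall>y\<in>B. \<exists>b. real (card {x\<in>A. f x y \<notin> {b..<b + 2 * (\<delta> + \<gamma> / 2)}}) < \<epsilon> / 4 * real (card A)"
      using Pa AB(1) sub(2) by blast
    then obtain b where b: "\<forall>y\<in>B. real (card {x\<in>A. f x y \<notin> {b y..<b y + 2 * (\<delta> + \<gamma> / 2)}}) < \<epsilon> / 4 * real (card A)"
      by (rule bchoice[THEN exE])
    have "almost_constant f \<epsilon> (2 * \<delta> + 2 * (\<delta> + \<gamma> / 2)) A B"
      using a b \<delta> \<delta>' by (intro almost_constant_of_intervals[OF fin ne \<epsilon>(2), where a = a and b = b]) auto
    then show ?thesis by (simp add: algebra_simps)
  qed
  with P Q show ?thesis by blast
qed

lemma sum_outside_eq: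
  assumes "finite C" and "finite D"
  shows "(\<Sum>x\<in>C. \<Sum>y\<in>D. of_bool ((x, y) \<notin> E)) = real (card C) * real (card D) - real (card (C \<times> D \<inter> E))"
proof -
  have "(\<Sum>x\<in>C. \<Sum>y\<in>D. of_bool ((x, y) \<notin> E)) = (\<Sum>z\<in>C \<times> D. of_bool (z \<notin> E) :: real)"
    by (simp add: sum.cartesian_product case_prod_beta)
  also have "\<dots> = real (card (C \<times> D - E))"
    using assms by (simp add: of_bool_def sum.If_cases Diff_eq Compl_eq)
  also have "\<dots> = real (card (C \<times> D)) - real (card (C \<times> D \<inter> E))"
    using assms card_Diff_subset_Int[of "C \<times> D" E] card_mono[of "C \<times> D" "C \<times> D \<inter> E"]
    by (simp add: of_nat_diff)
  finally show ?thesis by (simp add: card_cartesian_product)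
qed

text \<open>Definable partitions for \<open>\<epsilon> / 8\<close> are refined one side after the
  other. Parts of \<open>X\<close> control the density of exceptional points against each piece of
  \<open>Y\<close>; then parts of \<open>Y\<close> control it against the core of each part of
  \<open>X\<close> already found. So each refinement faces only boundedly many weights.\<close>

lemma regular_equipartitions:
  fixes k :: nat and \<delta> \<gamma> \<epsilon> :: real
  assumes k: "1 \<le> k" and \<delta>: "0 < \<delta>" and \<gamma>: "0 < \<gamma>" and \<epsilon>: "0 < \<epsilon>" "\<epsilon> < 1"
  shows "\<exists>N. \<forall>(X :: 'a set) (Y :: 'b set) f.
    finite X \<and> X \<noteq> {} \<and> finite Y \<and> Y \<noteq> {} \<and> unit_valued X Y f \<and> omits_ladders k \<delta> X Y f \<and>
    N \<le> card X \<and> N \<le> card Y \<longrightarrow>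
    (\<exists>P Q. equipartition X P \<and> equipartition Y Q \<and>
      real (card P) \<le> 62 * (17 / \<epsilon>) ^ (4 ^ (nat \<lceil>2 / \<gamma>\<rceil> * k)) \<and>
      real (card Q) \<le> 62 * (17 / \<epsilon>) ^ (4 ^ k) \<and>
      (\<forall>A\<in>P. \<forall>B\<in>Q. almost_constant f \<epsilon> (4 * \<delta> + \<gamma>) A B))"
proof -
  define K where "K = nat \<lceil>2 / \<gamma>\<rceil> * k"
  have "0 < \<lceil>2 / \<gamma>\<rceil>" using \<gamma> by simp
  then have K: "1 \<le> K" using k by (simp add: K_def Suc_le_eq)
  \<comment> \<open>Each refinement doubles the density and adds \<open>\<tau>\<close>: from
    \<open>\<epsilon> / 8\<close> to \<open>\<epsilon> / 4 + \<tau>\<close> to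
    \<open>\<epsilon> / 2 + 3 * \<tau>\<close>. Points outside the cores cost
    \<open>2 * \<tau>\<close> more, and \<open>\<epsilon> / 2 + 5 * \<tau>\<close> is
    \<open>21 * \<epsilon> / 22\<close>, below \<open>\<epsilon>\<close>.\<close>
  define \<tau> where "\<tau> = \<epsilon> / 11"
  have \<tau>: "0 < \<tau>" using \<epsilon> by (simp add: \<tau>_def)
  define G T where "G = nat \<lceil>2 / \<tau> + 1\<rceil>" and "T = nat \<lceil>2 / \<tau>\<rceil>"
  have "0 < 2 / \<tau>" using \<tau> by simp
  then have G: "2 / \<tau> + 1 \<le> real G" "real G < 2 / \<tau> + 2" and T: "2 / \<tau> \<le> real T"
    unfolding G_def T_def by linarith+
  have G24: "real G \<le> 24 / \<epsilon>"
  proof -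
    have "2 / \<tau> + 2 \<le> 22 / \<epsilon> + 2 / \<epsilon>" using \<epsilon> by (simp add: \<tau>_def field_simps)
    also have "\<dots> = 24 / \<epsilon>" by (simp add: add_divide_distrib[symmetric])
    finally show ?thesis using G(2) by linarith
  qed
  define S where "S i = nat \<lfloor>piece_bound i (\<epsilon> / 8)\<rfloor>" for i
  have pb1: "1 \<le> piece_bound i (\<epsilon> / 8)" for i using \<epsilon> by (simp add: piece_bound_def)
  have S: "0 < S i" "real (S i) \<le> piece_bound i (\<epsilon> / 8)" for i
  proof -
    have "1 \<le> \<lfloor>piece_bound i (\<epsilon> / 8)\<rfloor>" using pb1[of i] by simp
    then show "0 < S i" by (simp add: S_def)
    show "real (S i) \<le> piece_bound i (\<epsilon> / 8)" using pb1[of i] by (simp add: S_def)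
  qed
  have SG: "real (S i * G) \<le> 62 * (17 / \<epsilon>) ^ (4 ^ i)" if "1 \<le> i" for i
  proof -
    have "real (S i * G) \<le> piece_bound i (\<epsilon> / 8) * (24 / \<epsilon>)"
      unfolding of_nat_mult using S(2)[of i] G24 pb1[of i] by (intro mult_mono) auto
    also note refined_bound_le[OF that \<epsilon>]
    finally show ?thesis .
  qed
  define c where "c i r = max (S i * G) (nat \<lceil>4 * real (T + 1) ^ r / \<tau>\<rceil>)" for i r
  have c: "S i * G \<le> c i r" "4 * real (T + 1) ^ r \<le> \<tau> * real (c i r)" for i r
  proof -
    show "S i * G \<le> c i r" by (simp add: c_def)
    have "4 * real (T + 1) ^ r / \<tau> \<le> real (nat \<lceil>4 * real (T + 1) ^ r / \<tau>\<rceil>)" by linarith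
    also have "\<dots> \<le> real (c i r)" by (simp add: c_def)
    finally show "4 * real (T + 1) ^ r \<le> \<tau> * real (c i r)" using \<tau> by (simp add: field_simps)
  qed
  \<comment> \<open>\<open>X\<close> is refined against at most \<open>S k\<close> pieces of
    \<open>Y\<close>, then \<open>Y\<close> against at most \<open>S K * G\<close> parts of
    \<open>X\<close>; both numbers depend on the parameters alone.\<close>
  define N where "N = max (S K * G * c K (S k)) (S k * G * c k (S K * G))"
  show ?thesis
  proof (intro exI[of _ N] allI impI, elim conjE)
    fix X :: "'a set" and Y :: "'b set" and f
    assume X: "finite X" "X \<noteq> {}" and Y: "finite Y" "Y \<noteq> {}"
      and uv: "unit_valued X Y f" and om: "omits_ladders k \<delta> X Y f"
      and NX: "N \<le> card X" and NY: "N \<le> card Y"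
    have \<epsilon>8: "0 < \<epsilon> / 8" "\<epsilon> / 8 < 1" using \<epsilon> by auto
    obtain P Q where "definable_partition X Y f P" "definable_partition Y X (\<lambda>y x. f x y) Q"
      and pb: "real (card P) \<le> piece_bound K (\<epsilon> / 8)" "real (card Q) \<le> piece_bound k (\<epsilon> / 8)"
      and ac: "\<forall>A\<in>P. \<forall>B\<in>Q. almost_constant f (\<epsilon> / 8) (4 * \<delta> + \<gamma>) A B"
      using definable_regular_partitions[OF k \<delta> \<gamma> \<epsilon>8 X Y uv om] unfolding K_def by blast
    then have P: "partition_on X P" and Q: "partition_on Y Q" by (auto simp: definable_partition_def)
    have cP: "card P \<le> S K" and cQ: "card Q \<le> S k" using pb by (simp_all add: S_def le_nat_floor)
    have subP: "A \<subseteq> X" "finite A" "A \<noteq> {}" if "A \<in> P" for A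
      using that P X(1) by (auto simp: partition_on_def intro: finite_subset)
    have subQ: "B \<subseteq> Y" "finite B" "B \<noteq> {}" if "B \<in> Q" for B
      using that Q Y(1) by (auto simp: partition_on_def intro: finite_subset)
    have "\<forall>z\<in>P \<times> Q. \<exists>E. E \<subseteq> fst z \<times> snd z \<and>
        real (card E) > (1 - \<epsilon> / 8) * real (card (fst z)) * real (card (snd z)) \<and>
        (\<forall>(x, y)\<in>E. \<forall>(x', y')\<in>E. \<bar>f x y - f x' y'\<bar> < 4 * \<delta> + \<gamma>)"
      using ac by (auto simp: almost_constant_def)
    from bchoice[OF this] obtain E' where E': "\<forall>z\<in>P \<times> Q. E' z \<subseteq> fst z \<times> snd z \<and>
        real (card (E' z)) > (1 - \<epsilon> / 8) * real (card (fst z)) * real (card (snd z)) \<and>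
        (\<forall>(x, y)\<in>E' z. \<forall>(x', y')\<in>E' z. \<bar>f x y - f x' y'\<bar> < 4 * \<delta> + \<gamma>)" by blast
    \<comment> \<open>One set for all pairs: the rectangles \<open>A \<times> B\<close> are
      disjoint, so the nearly constant part of each pair can be recovered from the union.\<close>
    define E where "E = (\<Union>z\<in>P \<times> Q. E' z)"
    have EAB: "A \<times> B \<inter> E = E' (A, B)" if AB: "A \<in> P" "B \<in> Q" for A B
    proof
      show "E' (A, B) \<subseteq> A \<times> B \<inter> E" using E' AB by (force simp: E_def)
      show "A \<times> B \<inter> E \<subseteq> E' (A, B)"
      proof
        fix z assume "z \<in> A \<times> B \<inter> E"
        then obtain A' B' where z: "z \<in> A \<times> B" "A' \<in> P" "B' \<in> Q" "z \<in> E' (A', B')" by (auto simp: E_def)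
        then have "z \<in> A' \<times> B'" using E' by force
        with z AB P Q have "A' = A" "B' = B" unfolding partition_on_def disjoint_def by blast+
        with z show "z \<in> E' (A, B)" by simp
      qed
    qed
    define bad :: "'a \<Rightarrow> 'b \<Rightarrow> real" where "bad x y = of_bool ((x, y) \<notin> E)" for x y
    have bad01: "0 \<le> bad x y" "bad x y \<le> 1" for x y by (simp_all add: bad_def)
    have finPQ: "finite P" "finite Q" using P Q X(1) Y(1) finite_elements by blast+
    define wX where "wX B x = (\<Sum>y\<in>B. bad x y) / real (card B)" for B x
    have NX': "S K * G * c K (S k) \<le> card X" and NY': "S k * G * c k (S K * G) \<le> card Y"
      using NX NY by (simp_all add: N_def)
    have wX01: "wX B x \<in> {0..1}" for B x
      unfolding wX_def
    proof (cases "card B = 0")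
      case False
      have "(\<Sum>y\<in>B. bad x y) \<le> (\<Sum>y\<in>B. 1)" by (intro sum_mono bad01)
      moreover have "0 \<le> (\<Sum>y\<in>B. bad x y)" by (intro sum_nonneg bad01)
      ultimately show "(\<Sum>y\<in>B. bad x y) / real (card B) \<in> {0..1}" using False by (auto simp: divide_simps)
    qed simp
    from equipartition_refining[of X Q P "S K" "S k" wX \<tau> G T "c K (S k)",
        OF X(1) finPQ(2) P cP cQ wX01 \<tau> S(1) G(1) T NX' c]
    obtain P' cX where P': "equipartition X P'" "card P' \<le> S K * G" and cX: "\<forall>Z\<in>P'. cX Z \<subseteq> Z \<and> cX Z \<noteq> {} \<and>
        (1 - \<tau>) * real (card Z) \<le> real (card (cX Z)) \<and>
        (\<exists>A\<in>P. cX Z \<subseteq> A \<and> (\<forall>B\<in>Q. (\<Sum>x\<in>cX Z. wX B x) \<le>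
          real (card (cX Z)) * (2 * ((\<Sum>x\<in>A. wX B x) / real (card A)) + \<tau>)))"
      by (elim exE conjE)
    have partP': "partition_on X P'" using P'(1) by (simp add: equipartition_def)
    have finP': "finite P'" using partP' X(1) finite_elements by blast
    define wY where "wY Z y = (\<Sum>x\<in>cX Z. bad x y) / real (card (cX Z))" for Z y
    have wY01: "wY Z y \<in> {0..1}" for Z y
      unfolding wY_def
    proof (cases "card (cX Z) = 0")
      case False
      have "(\<Sum>x\<in>cX Z. bad x y) \<le> (\<Sum>x\<in>cX Z. 1)" by (intro sum_mono bad01)
      moreover have "0 \<le> (\<Sum>x\<in>cX Z. bad x y)" by (intro sum_nonneg bad01)
      ultimately show "(\<Sum>x\<in>cX Z. bad x y) / real (card (cX Z)) \<in> {0..1}" using False by (auto simp: divide_simps)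
    qed simp
    from equipartition_refining[of Y P' Q "S k" "S K * G" wY \<tau> G T "c k (S K * G)",
        OF Y(1) finP' Q cQ P'(2) wY01 \<tau> S(1) G(1) T NY' c]
    obtain Q' cY where Q': "equipartition Y Q'" "card Q' \<le> S k * G" and cY: "\<forall>V\<in>Q'. cY V \<subseteq> V \<and> cY V \<noteq> {} \<and>
        (1 - \<tau>) * real (card V) \<le> real (card (cY V)) \<and>
        (\<exists>B\<in>Q. cY V \<subseteq> B \<and> (\<forall>Z\<in>P'. (\<Sum>y\<in>cY V. wY Z y) \<le>
          real (card (cY V)) * (2 * ((\<Sum>y\<in>B. wY Z y) / real (card B)) + \<tau>)))"
      by (elim exE conjE)
    have partQ': "partition_on Y Q'" using Q'(1) by (simp add: equipartition_def)
    have "almost_constant f \<epsilon> (4 * \<delta> + \<gamma>) Z V" if ZV: "Z \<in> P'" "V \<in> Q'" for Z V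
    proof -
      from cX ZV(1) have Zc: "cX Z \<subseteq> Z" "cX Z \<noteq> {}" "(1 - \<tau>) * real (card Z) \<le> real (card (cX Z))" by auto
      from cX ZV(1) obtain A where A: "A \<in> P" "cX Z \<subseteq> A" and
        wA: "\<forall>B\<in>Q. (\<Sum>x\<in>cX Z. wX B x) \<le> real (card (cX Z)) * (2 * ((\<Sum>x\<in>A. wX B x) / real (card A)) + \<tau>)" by blast
      from cY ZV(2) have Vc: "cY V \<subseteq> V" "cY V \<noteq> {}" "(1 - \<tau>) * real (card V) \<le> real (card (cY V))" by auto
      from cY ZV(2) obtain B where B: "B \<in> Q" "cY V \<subseteq> B" and
        wB: "\<forall>Z\<in>P'. (\<Sum>y\<in>cY V. wY Z y) \<le> real (card (cY V)) * (2 * ((\<Sum>y\<in>B. wY Z y) / real (card B)) + \<tau>)" by blast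
      have fin: "finite (cX Z)" "finite (cY V)" 
        using finite_subset[OF A(2) subP(2)[OF A(1)]] finite_subset[OF B(2) subQ(2)[OF B(1)]] by simp_all
      have pos: "0 < real (card A)" "0 < real (card B)" "0 < real (card (cX Z))" "0 < real (card (cY V))"
        using subP[OF A(1)] subQ[OF B(1)] fin Zc(2) Vc(2) by (simp_all add: card_gt_0_iff)
      have "(1 - \<epsilon> / 8) * real (card A) * real (card B) < real (card (E' (A, B)))"
        using E'[rule_format, of "(A, B)"] A(1) B(1) by simp
      then have "(\<Sum>x\<in>A. \<Sum>y\<in>B. bad x y) \<le> \<epsilon> / 8 * real (card A) * real (card B)"
        unfolding bad_def sum_outside_eq[OF subP(2)[OF A(1)] subQ(2)[OF B(1)]] EAB[OF A(1) B(1)]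
        by (simp add: algebra_simps)
      then have "(\<Sum>x\<in>A. wX B x) / real (card A) \<le> \<epsilon> / 8"
        using pos by (simp add: wX_def sum_divide_distrib[symmetric] field_simps)
      then have "real (card (cX Z)) * (2 * ((\<Sum>x\<in>A. wX B x) / real (card A)) + \<tau>) \<le> real (card (cX Z)) * (\<epsilon> / 4 + \<tau>)"
        by (intro mult_left_mono) (linarith, simp)
      with wA B(1) have 1: "(\<Sum>x\<in>cX Z. wX B x) \<le> real (card (cX Z)) * (\<epsilon> / 4 + \<tau>)" by (meson order_trans)
      \<comment> \<open>Both sides are the density of exceptional points in
        \<open>cX Z \<times> B\<close>, averaged in either order; thus the bound of the first
        refinement enters the second.\<close>
      have "(\<Sum>y\<in>B. wY Z y) / real (card B) = (\<Sum>x\<in>cX Z. wX B x) / real (card (cX Z))"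
        unfolding wY_def wX_def sum_divide_distrib[symmetric]
        by (subst sum.swap) (simp add: mult.commute)
      also have "\<dots> \<le> \<epsilon> / 4 + \<tau>" using 1 pos by (simp add: divide_simps mult.commute)
      finally have "real (card (cY V)) * (2 * ((\<Sum>y\<in>B. wY Z y) / real (card B)) + \<tau>)
          \<le> real (card (cY V)) * (\<epsilon> / 2 + 3 * \<tau>)"
        by (intro mult_left_mono) (linarith, simp)
      with wB ZV(1) have 2: "(\<Sum>y\<in>cY V. wY Z y) \<le> real (card (cY V)) * (\<epsilon> / 2 + 3 * \<tau>)" by (meson order_trans)
      have "(\<Sum>x\<in>cX Z. \<Sum>y\<in>cY V. bad x y) = real (card (cX Z)) * (\<Sum>y\<in>cY V. wY Z y)"
        unfolding wY_def sum_divide_distrib[symmetric] using pos by (subst sum.swap) simp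
      also have "\<dots> \<le> real (card (cX Z)) * (real (card (cY V)) * (\<epsilon> / 2 + 3 * \<tau>))"
        using 2 by (intro mult_left_mono) auto
      finally have 3: "real (card (cX Z)) * real (card (cY V)) * (1 - (\<epsilon> / 2 + 3 * \<tau>)) \<le> real (card (cX Z \<times> cY V \<inter> E))"
        unfolding bad_def sum_outside_eq[OF fin] by (simp add: algebra_simps)
      have ZVfin: "finite Z" "finite V" "Z \<noteq> {}" "V \<noteq> {}"
        using ZV partP' partQ' X(1) Y(1) by (auto simp: partition_on_def intro: finite_subset)
      have \<tau>1: "\<tau> < 1" "\<epsilon> / 2 + 3 * \<tau> < 1" using \<epsilon> by (auto simp: \<tau>_def)
      have "((1 - \<tau>) * real (card Z)) * ((1 - \<tau>) * real (card V)) \<le> real (card (cX Z)) * real (card (cY V))"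
        using Zc(3) Vc(3) \<tau>1 by (intro mult_mono) auto
      then have "((1 - \<tau>) * real (card Z)) * ((1 - \<tau>) * real (card V)) * (1 - (\<epsilon> / 2 + 3 * \<tau>))
          \<le> real (card (cX Z)) * real (card (cY V)) * (1 - (\<epsilon> / 2 + 3 * \<tau>))"
        using \<tau>1 by (intro mult_right_mono) auto
      from order_trans[OF this 3] have 4: "(1 - \<tau>) * (1 - \<tau>) * (1 - (\<epsilon> / 2 + 3 * \<tau>)) * (real (card Z) * real (card V))
          \<le> real (card (cX Z \<times> cY V \<inter> E))" by (simp only: mult_ac)
      have "1 - \<epsilon> < 1 - \<epsilon> / 2 - 5 * \<tau>" using \<epsilon> by (simp add: \<tau>_def)
      also have "\<dots> \<le> (1 - \<tau>) * (1 - \<tau>) * (1 - (\<epsilon> / 2 + 3 * \<tau>))"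
      proof -
        have "(1 - 2 * \<tau>) * (1 - (\<epsilon> / 2 + 3 * \<tau>)) \<le> (1 - \<tau>) * (1 - \<tau>) * (1 - (\<epsilon> / 2 + 3 * \<tau>))"
          using \<tau>1 by (intro mult_right_mono) (auto simp: algebra_simps)
        moreover have "0 \<le> 2 * \<tau> * (\<epsilon> / 2 + 3 * \<tau>)" using \<tau> \<epsilon> by simp
        ultimately show ?thesis by (simp add: algebra_simps)
      qed
      finally have "(1 - \<epsilon>) * (real (card Z) * real (card V))
          < (1 - \<tau>) * (1 - \<tau>) * (1 - (\<epsilon> / 2 + 3 * \<tau>)) * (real (card Z) * real (card V))"
        using ZVfin by (intro mult_strict_right_mono) (auto simp: card_gt_0_iff)
      with 4 have "(1 - \<epsilon>) * real (card Z) * real (card V) < real (card (cX Z \<times> cY V \<inter> E))"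
        by (simp add: mult.assoc)
      moreover have "cX Z \<times> cY V \<inter> E \<subseteq> Z \<times> V" using Zc(1) Vc(1) by auto
      moreover have "\<forall>(x, y)\<in>cX Z \<times> cY V \<inter> E. \<forall>(x', y')\<in>cX Z \<times> cY V \<inter> E. \<bar>f x y - f x' y'\<bar> < 4 * \<delta> + \<gamma>"
      proof -
        have sub: "cX Z \<times> cY V \<inter> E \<subseteq> E' (A, B)" using A(2) B(2) EAB[OF A(1) B(1)] by blast
        have "(A, B) \<in> P \<times> Q" using A(1) B(1) by simp
        then have "\<forall>(x, y)\<in>E' (A, B). \<forall>(x', y')\<in>E' (A, B). \<bar>f x y - f x' y'\<bar> < 4 * \<delta> + \<gamma>"
          using E' by blast
        then have close: "\<bar>f x y - f x' y'\<bar> < 4 * \<delta> + \<gamma>"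
          if "(x, y) \<in> E' (A, B)" "(x', y') \<in> E' (A, B)" for x y x' y' using that by auto
        show ?thesis by (clarify, rule close; use sub in blast)
      qed
      ultimately show ?thesis unfolding almost_constant_def by blast
    qed
    moreover have "real (card P') \<le> 62 * (17 / \<epsilon>) ^ (4 ^ K)" using P'(2) SG[OF K] by linarith
    moreover have "real (card Q') \<le> 62 * (17 / \<epsilon>) ^ (4 ^ k)" using Q'(2) SG[OF k] by linarith
    ultimately show "\<exists>P Q. equipartition X P \<and> equipartition Y Q \<and>
      real (card P) \<le> 62 * (17 / \<epsilon>) ^ (4 ^ (nat \<lceil>2 / \<gamma>\<rceil> * k)) \<and>
      real (card Q) \<le> 62 * (17 / \<epsilon>) ^ (4 ^ k) \<and>
      (\<forall>A\<in>P. \<forall>B\<in>Q. almost_constant f \<epsilon> (4 * \<delta> + \<gamma>) A B)"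
      using P'(1) Q'(1) unfolding K_def by blast
  qed
qed

theorem theoremA9:
  fixes k :: nat and \<delta> \<gamma> \<epsilon> :: real
  assumes "k \<ge> 1" and "\<delta> > 0" and "\<gamma> > 0" and "\<epsilon> > 0" and "\<epsilon> < 1"
  shows
    "(\<forall>(X :: 'a set) (Y :: 'b set) (f :: 'a \<Rightarrow> 'b \<Rightarrow> real).
        finite X \<and> X \<noteq> {} \<and> finite Y \<and> Y \<noteq> {} \<and> unit_valued X Y f \<and> omits_ladders k \<delta> X Y f \<longrightarrow>
        (\<exists>P Q.
           definable_partition X Y f P \<and>
           definable_partition Y X (\<lambda>y x. f x y) Q \<and>
           real (card P) \<le> (9 / \<epsilon>) ^ (4 ^ (nat \<lceil>2 / \<gamma>\<rceil> * k)) \<and>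
           real (card Q) \<le> (9 / \<epsilon>) ^ (4 ^ k) \<and>
           (\<forall>A\<in>P. \<forall>B\<in>Q. almost_constant f \<epsilon> (4 * \<delta> + \<gamma>) A B))) \<and>
     (\<exists>N :: nat.
        (\<forall>(X :: 'a set) (Y :: 'b set) (f :: 'a \<Rightarrow> 'b \<Rightarrow> real).
           finite X \<and> X \<noteq> {} \<and> finite Y \<and> Y \<noteq> {} \<and> unit_valued X Y f \<and> omits_ladders k \<delta> X Y f \<and>
           card X \<ge> N \<and> card Y \<ge> N \<longrightarrow>
           (\<exists>P Q.
              equipartition X P \<and>
              equipartition Y Q \<and>
              real (card P) \<le> 62 * (17 / \<epsilon>) ^ (4 ^ (nat \<lceil>2 / \<gamma>\<rceil> * k)) \<and>
              real (card Q) \<le> 62 * (17 / \<epsilon>) ^ (4 ^ k) \<and>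
              (\<forall>A\<in>P. \<forall>B\<in>Q. almost_constant f \<epsilon> (4 * \<delta> + \<gamma>) A B))) \<and>
        (\<forall>(X :: nat set) (Y :: nat set) (f :: nat \<Rightarrow> nat \<Rightarrow> real).
           finite X \<and> X \<noteq> {} \<and> finite Y \<and> Y \<noteq> {} \<and> unit_valued X Y f \<and> omits_ladders k \<delta> X Y f \<and>
           card X \<ge> N \<and> card Y \<ge> N \<longrightarrow>
           (\<exists>P Q.
              equipartition X P \<and>
              equipartition Y Q \<and>
              real (card P) \<le> 62 * (17 / \<epsilon>) ^ (4 ^ (nat \<lceil>2 / \<gamma>\<rceil> * k)) \<and>
              real (card Q) \<le> 62 * (17 / \<epsilon>) ^ (4 ^ k) \<and>
              (\<forall>A\<in>P. \<forall>B\<in>Q. almost_constant f \<epsilon> (4 * \<delta> + \<gamma>) A B))))"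
proof -
  let ?K = "nat \<lceil>2 / \<gamma>\<rceil> * k"
  note regular = definable_regular_partitions[OF assms]
  have "0 < \<lceil>2 / \<gamma>\<rceil>" using \<open>\<gamma> > 0\<close> by simp
  then have "1 \<le> ?K" using \<open>k \<ge> 1\<close> by (simp add: Suc_le_eq)
  note bounds = piece_bound_le[OF this \<open>\<epsilon> > 0\<close> \<open>\<epsilon> < 1\<close>] piece_bound_le[OF \<open>k \<ge> 1\<close> \<open>\<epsilon> > 0\<close> \<open>\<epsilon> < 1\<close>]
  \<comment> \<open>The lemma gives a threshold for each pair of types separately; the maximum of
    the two thresholds serves both instances.\<close>
  from regular_equipartitions[OF assms, where 'a = 'a and 'b = 'b] obtain N1 where N1:
    "\<forall>(X :: 'a set) (Y :: 'b set) f.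
      finite X \<and> X \<noteq> {} \<and> finite Y \<and> Y \<noteq> {} \<and> unit_valued X Y f \<and> omits_ladders k \<delta> X Y f \<and>
      N1 \<le> card X \<and> N1 \<le> card Y \<longrightarrow>
      (\<exists>P Q. equipartition X P \<and> equipartition Y Q \<and>
        real (card P) \<le> 62 * (17 / \<epsilon>) ^ (4 ^ ?K) \<and> real (card Q) \<le> 62 * (17 / \<epsilon>) ^ (4 ^ k) \<and>
        (\<forall>A\<in>P. \<forall>B\<in>Q. almost_constant f \<epsilon> (4 * \<delta> + \<gamma>) A B))" ..
  from regular_equipartitions[OF assms, where 'a = nat and 'b = nat] obtain N2 where N2:
    "\<forall>(X :: nat set) (Y :: nat set) f.
      finite X \<and> X \<noteq> {} \<and> finite Y \<and> Y \<noteq> {} \<and> unit_valued X Y f \<and> omits_ladders k \<delta> X Y f \<and>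
      N2 \<le> card X \<and> N2 \<le> card Y \<longrightarrow>
      (\<exists>P Q. equipartition X P \<and> equipartition Y Q \<and>
        real (card P) \<le> 62 * (17 / \<epsilon>) ^ (4 ^ ?K) \<and> real (card Q) \<le> 62 * (17 / \<epsilon>) ^ (4 ^ k) \<and>
        (\<forall>A\<in>P. \<forall>B\<in>Q. almost_constant f \<epsilon> (4 * \<delta> + \<gamma>) A B))" ..
  show ?thesis
  proof (rule conjI)
    show "\<forall>(X :: 'a set) (Y :: 'b set) f.
        finite X \<and> X \<noteq> {} \<and> finite Y \<and> Y \<noteq> {} \<and> unit_valued X Y f \<and> omits_ladders k \<delta> X Y f \<longrightarrow>
        (\<exists>P Q. definable_partition X Y f P \<and> definable_partition Y X (\<lambda>y x. f x y) Q \<and>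
           real (card P) \<le> (9 / \<epsilon>) ^ (4 ^ ?K) \<and> real (card Q) \<le> (9 / \<epsilon>) ^ (4 ^ k) \<and>
           (\<forall>A\<in>P. \<forall>B\<in>Q. almost_constant f \<epsilon> (4 * \<delta> + \<gamma>) A B))"
    proof (intro allI impI, elim conjE)
      fix X :: "'a set" and Y :: "'b set" and f
      assume "finite X" "X \<noteq> {}" "finite Y" "Y \<noteq> {}" "unit_valued X Y f" "omits_ladders k \<delta> X Y f"
      from regular[OF this] obtain P Q where
        PQ: "definable_partition X Y f P" "definable_partition Y X (\<lambda>y x. f x y) Q"
          "\<forall>A\<in>P. \<forall>B\<in>Q. almost_constant f \<epsilon> (4 * \<delta> + \<gamma>) A B"
        and card: "real (card P) \<le> piece_bound ?K \<epsilon>" "real (card Q) \<le> piece_bound k \<epsilon>"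
        by (elim exE conjE)
      from card bounds have "real (card P) \<le> (9 / \<epsilon>) ^ (4 ^ ?K)" "real (card Q) \<le> (9 / \<epsilon>) ^ (4 ^ k)"
        by (blast intro: order_trans)+
      with PQ show "\<exists>P Q. definable_partition X Y f P \<and> definable_partition Y X (\<lambda>y x. f x y) Q \<and>
           real (card P) \<le> (9 / \<epsilon>) ^ (4 ^ ?K) \<and> real (card Q) \<le> (9 / \<epsilon>) ^ (4 ^ k) \<and>
           (\<forall>A\<in>P. \<forall>B\<in>Q. almost_constant f \<epsilon> (4 * \<delta> + \<gamma>) A B)"
        by (intro exI conjI)
    qed
  qed (rule exI[of _ "max N1 N2"], rule conjI, use N1 in simp, use N2 in simp)
qed

end
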